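(* Let $G:\mathbb{R}^n_+\to\mathbb{R}_+$ be a generating function of a generalized extreme value model, with homogeneity degree $1/\mu>0$, and suppose that there is a constant $M\in\mathbb{R}$ such that for all $x=(x^{(1)},\ldots,x^{(n)})^T\in\mathbb{R}^n_+$ with $x>0$ $$\sum_{i=1}^{n}\frac{\partial^2 G(x)}{\partial (x^{(i)})^2}\cdot \left(x^{(i)}\right)^2\le M\cdot G(x).$$ Let $E$ be the surplus function of the corresponding generalized extreme value model. Then its convex conjugate $E^*$ is $\beta$-strongly convex with respect to the norm $\|\cdot\|_1$, where $$\beta=\frac{1}{2(\mu M+1)-\frac{1}{\mu}}.$$
   Context: Here $\mathbb{R}^n_+$ is the set of vectors with nonnegative components and $x>0$ means that all components are positive. A random vector $\epsilon=(\epsilon^{(1)},\ldots,\epsilon^{(n)})^T$ defines a generalized extreme value model (GEV) if it has joint probability density function $$f_\epsilon(y^{(1)},\ldots,y^{(n)})=\frac{\partial^n \exp\left(-G\left(e^{-y^{(1)}},\ldots,e^{-y^{(n)}}\right)\right)}{\partial y^{(1)}\cdots\partial y^{(n)}},$$ where the generating function $G:\mathbb{R}^n_+\to\mathbb{R}_+$ has the following properties: (i) $G$ is homogeneous of degree $1/\mu>0$; (ii) $G(x^{(1)},\ldots,x^{(i)},\ldots,x^{(n)})\to\infty$ as $x^{(i)}\to\infty$, for each $i=1,\ldots,n$; (iii) for any $k$ distinct indices $i_1,\ldots,i_k$, the partial derivative $\frac{\partial^k G(x)}{\partial x^{(i_1)}\cdots\partial x^{(i_k)}}$ is $\ge 0$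 if $k$ is odd and $\le 0$ if $k$ is even. $G$ is assumed smooth enough on the open positive orthant that all partial derivatives mentioned exist there and $G$ is twice continuously differentiable there. Standing assumption: $\epsilon$ has finite mean and its distribution is absolutely continuous and fully supported on $\mathbb{R}^n$. The surplus function is $E(u)=\mathbb{E}_\epsilon\left(\max_{1\le i\le n}\left(u^{(i)}+\epsilon^{(i)}\right)\right)$, $u\in\mathbb{R}^n$; it is well known that for GEV $E(u)=\mu\ln G\left(e^{u^{(1)}},\ldots,e^{u^{(n)}}\right)+\mu\gamma$ with $\gamma$ Euler's constant. The convex conjugate is $E^*(p)=\sup_{u\in\mathbb{R}^n}\left(\langle p,u\rangle-E(u)\right)$; it is finite exactly on the simplex $\Delta=\{p\in\mathbb{R}^n\mid\sum_{i=1}^n p^{(i)}=1,\ p^{(i)}\ge0\}$. With $\|x\|_1=\sum_i|x^{(i)}|$, $E^*:\Delta\to\mathbb{R}$ is $\beta$-strongly convex with respect to $\|\cdot\|_1$ ($\beta>0$) if for all $p,q\in\Delta$ and $\alpha\in[0,1]$: $E^*(\alpha p+(1-\alpha)q)\le\alpha E^*(p)+(1-\alpha)E^*(q)-\frac{\beta}{2}\alpha(1-\alpha)\|p-q\|_1^2$. *)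

theory Defs
  imports "HOL-Probability.Probability"
begin

definition nonneg_orthant :: "(real ^ 'n::finite) set" where
  "nonneg_orthant = {x. \<forall>i. 0 \<le> x $ i}"

definition pos_orthant :: "(real ^ 'n::finite) set" where
  "pos_orthant = {x. \<forall>i. 0 < x $ i}"

definition partial_deriv :: "'n::finite \<Rightarrow> (real ^ 'n \<Rightarrow> real) \<Rightarrow> real ^ 'n \<Rightarrow> real" where
  "partial_deriv i f x = deriv (\<lambda>t. f (x + t *\<^sub>R axis i 1)) 0"

definition partially_differentiable_at :: "'n::finite \<Rightarrow> (real ^ 'n \<Rightarrow> real) \<Rightarrow> real ^ 'n \<Rightarrow> bool" where
  "partially_differentiable_at i f x \<longleftrightarrow>
     (\<lambda>t. f (x + t *\<^sub>R axis i 1)) field_differentiable (at 0)"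

(* The head of the list is the outermost derivative. *)
definition mixed_partial :: "'n::finite list \<Rightarrow> (real ^ 'n \<Rightarrow> real) \<Rightarrow> real ^ 'n \<Rightarrow> real" where
  "mixed_partial js f = foldr partial_deriv js f"

definition C2_on :: "(real ^ 'n::finite \<Rightarrow> real) \<Rightarrow> (real ^ 'n) set \<Rightarrow> bool" where
  "C2_on f S \<longleftrightarrow>
     (\<exists>(f' :: real ^ 'n \<Rightarrow> ((real ^ 'n) \<Rightarrow>\<^sub>L real))
       (f'' :: real ^ 'n \<Rightarrow> ((real ^ 'n) \<Rightarrow>\<^sub>L ((real ^ 'n) \<Rightarrow>\<^sub>L real))).
        (\<forall>x\<in>S. (f has_derivative blinfun_apply (f' x)) (at x)) \<and>
        (\<forall>x\<in>S. (f' has_derivative blinfun_apply (f'' x)) (at x)) \<and>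
        continuous_on S f'')"

(* Only the values of G on the nonnegative orthant matter. Beyond second order, mixed partials
   are not assumed continuous, so existence and sign are required for every order of
   differentiation in distinct variables. *)
definition gev_generating :: "real \<Rightarrow> (real ^ 'n::finite \<Rightarrow> real) \<Rightarrow> bool" where
  "gev_generating \<mu> G \<longleftrightarrow>
     0 < 1 / \<mu> \<and>
     (\<forall>x\<in>nonneg_orthant. 0 \<le> G x) \<and>
     (\<forall>x\<in>nonneg_orthant. \<forall>t>0. G (t *\<^sub>R x) = t powr (1 / \<mu>) * G x) \<and>
     (\<forall>x\<in>nonneg_orthant. \<forall>i.
        filterlim (\<lambda>t. G (\<chi> j. if j = i then t else x $ j)) at_top at_top) \<and>
     C2_on G pos_orthant \<and>
     (\<forall>js i. distinct (i # js) \<longrightarrow>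
        (\<forall>x\<in>pos_orthant. partially_differentiable_at i (mixed_partial js G) x)) \<and>
     (\<forall>js. distinct js \<and> js \<noteq> [] \<longrightarrow>
        (\<forall>x\<in>pos_orthant.
           (odd (length js) \<longrightarrow> 0 \<le> mixed_partial js G x) \<and>
           (even (length js) \<longrightarrow> mixed_partial js G x \<le> 0)))"

(* The list js enumerates the coordinates, in the order in which the n-th mixed partial
   derivative is taken. Nonnegativity of the density is stated separately because ennreal
   truncates negative values to 0. Absolute continuity of the law is part of distributed. *)
definition gev_random_vector ::
  "(real ^ 'n::finite \<Rightarrow> real) \<Rightarrow> 'a measure \<Rightarrow> ('a \<Rightarrow> real ^ 'n) \<Rightarrow> bool" where
  "gev_random_vector G P \<epsilon> \<longleftrightarrow>
     prob_space P \<and>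
     (\<exists>js. distinct js \<and> set js = UNIV \<and>
        (let f = mixed_partial js (\<lambda>y. exp (- G (\<chi> i. exp (- (y $ i)))))
         in (\<forall>y. 0 \<le> f y) \<and> distributed P lborel \<epsilon> (\<lambda>y. ennreal (f y)))) \<and>
     integrable P \<epsilon> \<and>
     (\<forall>U. open U \<and> U \<noteq> {} \<longrightarrow> 0 < measure P (\<epsilon> -` U \<inter> space P))"

definition surplus :: "'a measure \<Rightarrow> ('a \<Rightarrow> real ^ 'n::finite) \<Rightarrow> real ^ 'n \<Rightarrow> real" where
  "surplus P \<epsilon> u = integral\<^sup>L P (\<lambda>\<omega>. MAX i. u $ i + \<epsilon> \<omega> $ i)"

definition convex_conjugate :: "('v::real_inner \<Rightarrow> real) \<Rightarrow> 'v \<Rightarrow> ereal" where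
  "convex_conjugate f p = (SUP u. ereal (p \<bullet> u - f u))"

definition unit_simplex :: "(real ^ 'n::finite) set" where
  "unit_simplex = {p. (\<Sum>i\<in>UNIV. p $ i) = 1 \<and> (\<forall>i. 0 \<le> p $ i)}"

definition norm1 :: "real ^ 'n::finite \<Rightarrow> real" where
  "norm1 x = (\<Sum>i\<in>UNIV. \<bar>x $ i\<bar>)"

(* The first conjunct after positivity of beta says that f is real-valued on S. *)
definition strongly_convex_on ::
  "real \<Rightarrow> ('v::real_vector \<Rightarrow> real) \<Rightarrow> 'v set \<Rightarrow> ('v \<Rightarrow> ereal) \<Rightarrow> bool" where
  "strongly_convex_on \<beta> N S f \<longleftrightarrow>
     0 < \<beta> \<and>
     (\<forall>p\<in>S. \<bar>f p\<bar> \<noteq> \<infinity>) \<and>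
     (\<forall>p\<in>S. \<forall>q\<in>S. \<forall>\<alpha>\<in>{0..1}.
        f (\<alpha> *\<^sub>R p + (1 - \<alpha>) *\<^sub>R q)
          \<le> ereal \<alpha> * f p + ereal (1 - \<alpha>) * f q
             - ereal (\<beta> / 2 * \<alpha> * (1 - \<alpha>) * (N (p - q))\<^sup>2))"

end

theory Submission
  imports Defs
begin

text \<open>
  Write \<open>L = 2 (\<mu> M + 1) - 1/\<mu>\<close>, so that \<open>\<beta> = 1/L\<close>. By duality it suffices to show that the
  surplus function \<open>E\<close> is \<open>L\<close>-smooth with respect to the maximum norm, the dual of \<open>\<parallel>\<cdot>\<parallel>\<^sub>1\<close>:
  testing the conjugate at \<open>p\<close> with \<open>u + (1 - \<alpha>) h\<close> and at \<open>q\<close> with \<open>u - \<alpha> h\<close>, where \<open>h\<close> is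
  \<open>\<parallel>p - q\<parallel>\<^sub>1 / L\<close> times the vector of signs of \<open>p - q\<close>, yields the strong convexity inequality
  (\<open>strongly_convex_conjugate\<close>). The conjugate is finite on the simplex because a maximum
  dominates every weighted average (\<open>surplus_conjugate_finite\<close>).

  For smoothness the formula \<open>E(u) = \<mu> ln G(e\<^sup>u) + c\<close> is needed, with some constant \<open>c\<close>
  (\<open>surplus_eq\<close>). The density integrates to the distribution function
  \<open>F(y) = exp (- G(e\<^bsup>-y\<^esup>))\<close> (\<open>gev_cdf\<close>), so by homogeneity \<open>max\<^sub>i (u\<^sub>i + \<epsilon>\<^sub>i) - \<mu> ln G(e\<^sup>u)\<close> has
  distribution function \<open>exp (- e\<^bsup>-t/\<mu>\<^esup>)\<close> for every \<open>u\<close>, hence a mean that does not depend on \<open>u\<close>.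
  As the mixed partials of \<open>G\<close> of order three and more need not be continuous, \<open>F\<close> is recovered as
  follows: being a nonnegative derivative, the density can be integrated one coordinate at a time
  over a box by the fundamental theorem of calculus, which gives an alternating sum of values
  of \<open>F\<close> at the corners (\<open>nn_integral_mixed_partial_box\<close>); then the lower corners are sent to
  \<open>-\<infinity>\<close>, where \<open>F\<close> vanishes because \<open>G\<close> is unbounded in each variable
  (\<open>measure_lower_orthant\<close>).

  The Hessian bound (\<open>gev_log_smooth\<close>) is computed along a line \<open>t \<mapsto> u + t h\<close> with
  \<open>\<bar>h\<^sub>i\<bar> \<le> s\<close>. Put \<open>x = e\<^bsup>u + t h\<^esup>\<close>, \<open>g(t) = G(x)\<close>, \<open>d\<^sub>i = x\<^sub>i G\<^sub>i\<close> and \<open>A\<^sub>i\<^sub>j = x\<^sub>i x\<^sub>j G\<^sub>i\<^sub>j\<close>. Then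
  \<open>g'' = \<Sum> A\<^sub>i\<^sub>j h\<^sub>i h\<^sub>j + \<Sum> d\<^sub>i h\<^sub>i\<^sup>2\<close>, and Euler's identities give \<open>\<Sum>\<^sub>i d\<^sub>i = G/\<mu>\<close> and
  \<open>\<Sum>\<^sub>j A\<^sub>i\<^sub>j = (1/\<mu> - 1) d\<^sub>i\<close>. Since the entries off the diagonal are nonpositive, their total size
  is controlled by the row sums and by the trace, which is at most \<open>M G\<close>. This yields
  \<open>\<mu> g'' \<le> L s\<^sup>2 g\<close> (\<open>quadratic_form_bound\<close>), and \<open>(ln g)'' \<le> g''/g\<close>.
\<close>

section \<open>Convex conjugates of smooth functions\<close>

lemma conjugate_ge: "ereal (p \<bullet> u - f u) \<le> convex_conjugate f p"
  unfolding convex_conjugate_def by (rule SUP_upper) simp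

lemma inner_sgn_norm1:
  fixes d :: "real ^ 'n::finite"
  shows "d \<bullet> (\<chi> i. s * sgn (d $ i)) = s * norm1 d"
proof -
  have eq: "d $ i * (s * sgn (d $ i)) = s * \<bar>d $ i\<bar>" for i
    by (simp add: abs_sgn)
  show ?thesis
    by (simp add: inner_vec_def norm1_def sum_distrib_left eq del: mult_cancel_left)
qed

text \<open>
  The hypothesis \<open>smooth\<close> is \<open>L\<close>-smoothness with respect to the maximum norm, stated without
  derivatives.
\<close>
lemma strongly_convex_conjugate:
  fixes E :: "real ^ 'n::finite \<Rightarrow> real"
  assumes L: "0 < L"
    and fin: "\<And>p. p \<in> S \<Longrightarrow> \<bar>convex_conjugate E p\<bar> \<noteq> \<infinity>"
    and smooth: "\<And>u h s \<alpha>. (\<And>i. \<bar>h $ i\<bar> \<le> s) \<Longrightarrow> 0 \<le> \<alpha> \<Longrightarrow> \<alpha> \<le> 1 \<Longrightarrow>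
       \<alpha> * E (u + (1 - \<alpha>) *\<^sub>R h) + (1 - \<alpha>) * E (u - \<alpha> *\<^sub>R h)
         \<le> E u + L / 2 * \<alpha> * (1 - \<alpha>) * s\<^sup>2"
  shows "strongly_convex_on (1 / L) norm1 S (convex_conjugate E)"
  unfolding strongly_convex_on_def
proof (intro conjI ballI)
  show "0 < 1 / L" using L by simp
  show "\<bar>convex_conjugate E p\<bar> \<noteq> \<infinity>" if "p \<in> S" for p using fin that .
  fix p q \<alpha> assume p: "p \<in> S" and q: "q \<in> S" and "\<alpha> \<in> {0..1::real}"
  then have \<alpha>: "0 \<le> \<alpha>" "\<alpha> \<le> 1" by auto
  obtain a where a: "convex_conjugate E p = ereal a" using fin[OF p] by auto
  obtain b where b: "convex_conjugate E q = ereal b" using fin[OF q] by auto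
  \<comment> \<open>This \<open>s\<close> maximizes \<open>s \<parallel>p - q\<parallel>\<^sub>1 - L s\<^sup>2 / 2\<close>.\<close>
  define s where "s = norm1 (p - q) / L"
  define h where "h = (\<chi> i. s * sgn ((p - q) $ i))"
  have "0 \<le> s" using L by (simp add: s_def norm1_def sum_nonneg)
  then have h: "\<bar>h $ i\<bar> \<le> s" for i
    by (simp add: h_def abs_mult sgn_if)
  have ph: "p \<bullet> h - q \<bullet> h = L * s\<^sup>2"
    using inner_sgn_norm1[of "p - q" s] L
    by (simp add: h_def s_def inner_diff_left power2_eq_square)
  have *: "(\<alpha> *\<^sub>R p + (1 - \<alpha>) *\<^sub>R q) \<bullet> u - E u
      \<le> \<alpha> * a + (1 - \<alpha>) * b - 1 / L / 2 * \<alpha> * (1 - \<alpha>) * (norm1 (p - q))\<^sup>2" for u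
  proof -
    have "p \<bullet> (u + (1 - \<alpha>) *\<^sub>R h) - E (u + (1 - \<alpha>) *\<^sub>R h) \<le> a"
      using conjugate_ge[of p "u + (1 - \<alpha>) *\<^sub>R h" E] a by simp
    then have 1: "\<alpha> * (p \<bullet> (u + (1 - \<alpha>) *\<^sub>R h) - E (u + (1 - \<alpha>) *\<^sub>R h)) \<le> \<alpha> * a"
      using \<alpha> by (intro mult_left_mono) auto
    have "q \<bullet> (u - \<alpha> *\<^sub>R h) - E (u - \<alpha> *\<^sub>R h) \<le> b"
      using conjugate_ge[of q "u - \<alpha> *\<^sub>R h" E] b by simp
    then have 2: "(1 - \<alpha>) * (q \<bullet> (u - \<alpha> *\<^sub>R h) - E (u - \<alpha> *\<^sub>R h)) \<le> (1 - \<alpha>) * b"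
      using \<alpha> by (intro mult_left_mono) auto
    note 3 = smooth[of h s \<alpha> u, OF h \<alpha>]
    have 4: "\<alpha> * (1 - \<alpha>) * (p \<bullet> h - q \<bullet> h) = \<alpha> * (1 - \<alpha>) * (L * s\<^sup>2)"
      using ph by simp
    have 5: "1 / L / 2 * \<alpha> * (1 - \<alpha>) * (norm1 (p - q))\<^sup>2 = L / 2 * \<alpha> * (1 - \<alpha>) * s\<^sup>2"
      using L by (simp add: s_def power2_eq_square)
    have 6: "\<alpha> * (p \<bullet> (u + (1 - \<alpha>) *\<^sub>R h) - E (u + (1 - \<alpha>) *\<^sub>R h))
        + (1 - \<alpha>) * (q \<bullet> (u - \<alpha> *\<^sub>R h) - E (u - \<alpha> *\<^sub>R h))
      = (\<alpha> *\<^sub>R p + (1 - \<alpha>) *\<^sub>R q) \<bullet> u + \<alpha> * (1 - \<alpha>) * (p \<bullet> h - q \<bullet> h)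
        - (\<alpha> * E (u + (1 - \<alpha>) *\<^sub>R h) + (1 - \<alpha>) * E (u - \<alpha> *\<^sub>R h))"
      by (simp add: inner_simps) (simp add: algebra_simps)
    have 7: "\<alpha> * (1 - \<alpha>) * (L * s\<^sup>2) = 2 * (L / 2 * \<alpha> * (1 - \<alpha>) * s\<^sup>2)"
      by simp
    show ?thesis
      unfolding 5 using 1 2 3 4 6 7 by linarith
  qed
  have "convex_conjugate E (\<alpha> *\<^sub>R p + (1 - \<alpha>) *\<^sub>R q)
      \<le> ereal (\<alpha> * a + (1 - \<alpha>) * b - 1 / L / 2 * \<alpha> * (1 - \<alpha>) * (norm1 (p - q))\<^sup>2)"
    unfolding convex_conjugate_def using * by (intro SUP_least) simp
  then show "convex_conjugate E (\<alpha> *\<^sub>R p + (1 - \<alpha>) *\<^sub>R q)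
      \<le> ereal \<alpha> * convex_conjugate E p + ereal (1 - \<alpha>) * convex_conjugate E q
         - ereal (1 / L / 2 * \<alpha> * (1 - \<alpha>) * (norm1 (p - q))\<^sup>2)"
    by (simp add: a b)
qed

section \<open>Quadratic forms with nonpositive off-diagonal entries\<close>

text \<open>
  The abstract form of the Hessian estimate. Each row is bounded separately; the diagonal
  coefficient \<open>A\<^sub>i\<^sub>i + d\<^sub>i\<close> of \<open>h\<^sub>i\<^sup>2\<close> is nonnegative although \<open>A\<^sub>i\<^sub>i\<close> need not be.
\<close>
lemma quadratic_form_bound:
  fixes A :: "'n::finite \<Rightarrow> 'n \<Rightarrow> real" and d h :: "'n \<Rightarrow> real"
  assumes d: "\<And>i. 0 \<le> d i"
    and off: "\<And>i j. i \<noteq> j \<Longrightarrow> A i j \<le> 0"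
    and row: "\<And>i. (\<Sum>j\<in>UNIV. A i j) = (c - 1) * d i"
    and c: "0 \<le> c" and h: "\<And>i. \<bar>h i\<bar> \<le> s"
  shows "(\<Sum>i\<in>UNIV. \<Sum>j\<in>UNIV. A i j * h i * h j) + (\<Sum>i\<in>UNIV. d i * (h i)\<^sup>2)
     \<le> s\<^sup>2 * (2 * (\<Sum>i\<in>UNIV. A i i) + (2 - c) * (\<Sum>i\<in>UNIV. d i))"
proof -
  have s: "0 \<le> s" using h[of undefined] by linarith
  have split: "(\<Sum>j\<in>UNIV. f j) = f i + (\<Sum>j\<in>UNIV - {i}. f j)" for f :: "'n \<Rightarrow> real" and i
    by (simp add: sum.remove)
  have hh: "(h i)\<^sup>2 \<le> s\<^sup>2" for i
    using h[of i] s by (simp add: abs_le_square_iff[symmetric])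
  have "(\<Sum>j\<in>UNIV. A i j * h i * h j) + d i * (h i)\<^sup>2
      \<le> s\<^sup>2 * (2 * A i i + (2 - c) * d i)" for i
  proof -
    have off': "(\<Sum>j\<in>UNIV - {i}. A i j * h i * h j) \<le> - s\<^sup>2 * (\<Sum>j\<in>UNIV - {i}. A i j)"
      unfolding sum_distrib_left
    proof (rule sum_mono)
      fix j assume "j \<in> UNIV - {i}"
      then have Aij: "A i j \<le> 0" using off by simp
      have "\<bar>h i * h j\<bar> \<le> s * s"
        unfolding abs_mult using h[of i] h[of j] s by (intro mult_mono) auto
      then have "- (s * s) \<le> h i * h j" by linarith
      then have "A i j * (h i * h j) \<le> A i j * (- (s * s))"
        using Aij by (intro mult_left_mono_neg)
      then show "A i j * h i * h j \<le> - s\<^sup>2 * A i j"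
        by (simp add: power2_eq_square algebra_simps)
    qed
    have rowi: "A i i + (\<Sum>j\<in>UNIV - {i}. A i j) = (c - 1) * d i"
      using row[of i] split[of "A i" i] by simp
    have "(\<Sum>j\<in>UNIV - {i}. A i j) \<le> 0"
      using off by (intro sum_nonpos) auto
    moreover have "0 \<le> c * d i" using c d[of i] by simp
    ultimately have "0 \<le> A i i + d i" using rowi by (simp add: algebra_simps)
    then have "(A i i + d i) * (h i)\<^sup>2 \<le> (A i i + d i) * s\<^sup>2"
      using hh by (rule mult_left_mono[rotated])
    moreover have "(\<Sum>j\<in>UNIV. A i j * h i * h j)
        = A i i * (h i)\<^sup>2 + (\<Sum>j\<in>UNIV - {i}. A i j * h i * h j)"
      using split[of "\<lambda>j. A i j * h i * h j" i] by (simp add: power2_eq_square)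
    moreover have "(\<Sum>j\<in>UNIV - {i}. A i j) = (c - 1) * d i - A i i"
      using rowi by simp
    then have "- s\<^sup>2 * (\<Sum>j\<in>UNIV - {i}. A i j) = - s\<^sup>2 * ((c - 1) * d i - A i i)"
      by simp
    ultimately show ?thesis using off' by (simp add: algebra_simps)
  qed
  then have "(\<Sum>i\<in>UNIV. (\<Sum>j\<in>UNIV. A i j * h i * h j) + d i * (h i)\<^sup>2)
      \<le> (\<Sum>i\<in>UNIV. s\<^sup>2 * (2 * A i i + (2 - c) * d i))"
    by (rule sum_mono)
  then show ?thesis
    by (simp add: sum.distrib sum_distrib_left[symmetric])
qed

lemma diagonal_lower_bound:
  fixes A :: "'n::finite \<Rightarrow> 'n \<Rightarrow> real"
  assumes off: "\<And>i j. i \<noteq> j \<Longrightarrow> A i j \<le> 0"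
    and row: "\<And>i. (\<Sum>j\<in>UNIV. A i j) = (c - 1) * d i"
  shows "(c - 1) * (\<Sum>i\<in>UNIV. d i) \<le> (\<Sum>i\<in>UNIV. A i i)"
proof -
  have "(c - 1) * d i \<le> A i i" for i
  proof -
    have "(\<Sum>j\<in>UNIV. A i j) = A i i + (\<Sum>j\<in>UNIV - {i}. A i j)"
      by (simp add: sum.remove)
    moreover have "(\<Sum>j\<in>UNIV - {i}. A i j) \<le> 0"
      using off by (intro sum_nonpos) auto
    ultimately show ?thesis using row[of i] by linarith
  qed
  then show ?thesis by (simp add: sum_distrib_left sum_mono)
qed

section \<open>The expected maximum\<close>

lemma Max_ge_average:
  fixes p z :: "real ^ 'n::finite"
  assumes "p \<in> unit_simplex"
  shows "p \<bullet> z \<le> (MAX i. z $ i)"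
proof -
  have "p \<bullet> z = (\<Sum>i\<in>UNIV. p $ i * z $ i)" by (simp add: inner_vec_def)
  also have "\<dots> \<le> (\<Sum>i\<in>UNIV. p $ i * (MAX i. z $ i))"
    using assms by (intro sum_mono mult_left_mono) (auto simp: unit_simplex_def)
  also have "\<dots> = (MAX i. z $ i)"
    using assms by (simp add: unit_simplex_def sum_distrib_right[symmetric])
  finally show ?thesis .
qed

lemma Max_vec_le_iff: "(MAX i. (z :: real ^ 'n::finite) $ i) \<le> t \<longleftrightarrow> (\<forall>i. z $ i \<le> t)"
  by (subst Max_le_iff) auto

lemma borel_measurable_vec_nth [measurable]: "(\<lambda>x :: real ^ 'n::finite. x $ i) \<in> borel_measurable borel"
  by (intro borel_measurable_continuous_onI continuous_intros)

lemma integrable_Max_vec: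
  fixes \<epsilon> :: "'a \<Rightarrow> real ^ 'n::finite"
  assumes "prob_space P" and "integrable P \<epsilon>"
  shows "integrable P (\<lambda>\<omega>. MAX i. u $ i + \<epsilon> \<omega> $ i)"
proof -
  interpret prob_space P by fact
  have [measurable]: "\<epsilon> \<in> borel_measurable P" using assms by auto
  have [measurable]: "(\<lambda>\<omega>. u $ i + \<epsilon> \<omega> $ i) \<in> borel_measurable P" for i
    by measurable
  have meas: "(\<lambda>\<omega>. MAX i. u $ i + \<epsilon> \<omega> $ i) \<in> borel_measurable P"
    by (rule borel_measurable_Max) auto
  have bound: "integrable P (\<lambda>\<omega>. norm (u + \<epsilon> \<omega>))"
    by (intro integrable_norm Bochner_Integration.integrable_add integrable_const assms(2))
  show ?thesis
  proof (rule Bochner_Integration.integrable_bound[OF bound meas], intro AE_I2)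
    fix \<omega>
    have "(MAX i. (u + \<epsilon> \<omega>) $ i) \<in> range (\<lambda>i. (u + \<epsilon> \<omega>) $ i)"
      by (rule Max_in) auto
    then obtain i where "(MAX i. (u + \<epsilon> \<omega>) $ i) = (u + \<epsilon> \<omega>) $ i" by blast
    moreover have "\<bar>(u + \<epsilon> \<omega>) $ i\<bar> \<le> norm (u + \<epsilon> \<omega>)" by (rule component_le_norm_cart)
    ultimately show "norm (MAX i. u $ i + \<epsilon> \<omega> $ i) \<le> norm (norm (u + \<epsilon> \<omega>))"
      by simp
  qed
qed

lemma surplus_conjugate_finite:
  fixes \<epsilon> :: "'a \<Rightarrow> real ^ 'n::finite"
  assumes P: "prob_space P" and \<epsilon>: "integrable P \<epsilon>" and p: "p \<in> unit_simplex"
  shows "\<bar>convex_conjugate (surplus P \<epsilon>) p\<bar> \<noteq> \<infinity>"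
proof -
  interpret prob_space P by fact
  have "p \<bullet> u - surplus P \<epsilon> u \<le> - (p \<bullet> expectation \<epsilon>)" for u
  proof -
    have "p \<bullet> u + p \<bullet> expectation \<epsilon> = expectation (\<lambda>\<omega>. p \<bullet> u + p \<bullet> \<epsilon> \<omega>)"
      using \<epsilon> by (simp add: prob_space)
    also have "\<dots> \<le> surplus P \<epsilon> u"
      unfolding surplus_def
    proof (rule integral_mono)
      show "p \<bullet> u + p \<bullet> \<epsilon> \<omega> \<le> (MAX i. u $ i + \<epsilon> \<omega> $ i)" for \<omega>
        using Max_ge_average[OF p, of "u + \<epsilon> \<omega>"] by (simp add: inner_add_right)
    qed (use \<epsilon> integrable_Max_vec[OF P \<epsilon>] in auto)
    finally show ?thesis by simp
  qed
  then have "convex_conjugate (surplus P \<epsilon>) p \<le> ereal (- (p \<bullet> expectation \<epsilon>))"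
    unfolding convex_conjugate_def by (intro SUP_least) simp
  moreover have "ereal (p \<bullet> 0 - surplus P \<epsilon> 0) \<le> convex_conjugate (surplus P \<epsilon>) p"
    by (rule conjugate_ge)
  ultimately show ?thesis by auto
qed

section \<open>Partial derivatives, homogeneity and curves\<close>

lemma open_pos_orthant: "open (pos_orthant :: (real ^ 'n::finite) set)"
proof -
  have "pos_orthant = (\<Inter>i. {x :: real ^ 'n. 0 < x $ i})" by (auto simp: pos_orthant_def)
  moreover have "open (\<Inter>i. {x :: real ^ 'n. 0 < x $ i})"
    by (intro open_INT ballI open_Collect_less continuous_intros) auto
  ultimately show ?thesis by simp
qed

lemma partial_deriv_eq:
  assumes "(f has_derivative f') (at x)"
  shows "partial_deriv i f x = f' (axis i 1)"
proof -
  have "((\<lambda>t. x + t *\<^sub>R axis i 1) has_derivative (\<lambda>t. t *\<^sub>R axis i 1)) (at (0::real))"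
    by (auto intro!: derivative_eq_intros)
  moreover have "(f has_derivative f') (at (x + 0 *\<^sub>R axis i (1::real)))" using assms by simp
  ultimately have "((\<lambda>t. f (x + t *\<^sub>R axis i 1)) has_derivative (\<lambda>t. f' (t *\<^sub>R axis i 1))) (at 0)"
    by (rule has_derivative_compose)
  moreover have "(\<lambda>t. f' (t *\<^sub>R axis i 1)) = (\<lambda>t. f' (axis i 1) * t)"
    using has_derivative_bounded_linear[OF assms] 
    by (simp add: linear_simps mult.commute)
  ultimately show ?thesis
    unfolding partial_deriv_def by (intro DERIV_imp_deriv) (simp add: has_field_derivative_def)
qed

lemma partial_deriv_cong_open:
  assumes "open S" "x \<in> S" "\<And>y. y \<in> S \<Longrightarrow> f y = g y"
  shows "partial_deriv i f x = partial_deriv i g x"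
proof -
  have "((\<lambda>t::real. x + t *\<^sub>R axis i 1) \<longlongrightarrow> x + 0 *\<^sub>R axis i 1) (nhds 0)"
    by (intro tendsto_intros filterlim_ident)
  then have "eventually (\<lambda>t. x + t *\<^sub>R axis i 1 \<in> S) (nhds (0::real))"
    using assms(1,2) by (auto dest!: topological_tendstoD)
  then have "eventually (\<lambda>t. f (x + t *\<^sub>R axis i 1) = g (x + t *\<^sub>R axis i 1)) (nhds 0)"
    by eventually_elim (rule assms(3))
  then show ?thesis
    unfolding partial_deriv_def by (intro deriv_cong_ev) auto
qed

lemma vec_eq_sum_axis: "(x :: real ^ 'n::finite) = (\<Sum>i\<in>UNIV. x $ i *\<^sub>R axis i 1)"
  by (simp add: vec_eq_iff axis_def if_distrib cong: if_cong)

lemma linear_vec_sum: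
  fixes x :: "real ^ 'n::finite"
  assumes "bounded_linear f"
  shows "f x = (\<Sum>i\<in>UNIV. x $ i *\<^sub>R f (axis i 1))"
proof -
  interpret bounded_linear f by fact
  have "f x = f (\<Sum>i\<in>UNIV. x $ i *\<^sub>R axis i 1)" using vec_eq_sum_axis[of x] by simp
  then show ?thesis by (simp add: sum scaleR)
qed

text \<open>Euler's identity needs homogeneity along the ray through the point only.\<close>
lemma euler_homogeneous:
  fixes f :: "'v::real_normed_vector \<Rightarrow> real"
  assumes f: "(f has_derivative f') (at x)"
    and hom: "\<And>t. t > 0 \<Longrightarrow> f (t *\<^sub>R x) = t powr c * f x"
  shows "f' x = c * f x"
proof -
  have "((\<lambda>t. t *\<^sub>R x) has_derivative (\<lambda>t. t *\<^sub>R x)) (at (1::real))"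
    by (auto intro!: derivative_eq_intros)
  moreover have "(f has_derivative f') (at (1 *\<^sub>R x))" using f by simp
  ultimately have "((\<lambda>t. f (t *\<^sub>R x)) has_derivative (\<lambda>t. f' (t *\<^sub>R x))) (at (1::real))"
    by (rule has_derivative_compose)
  then have "((\<lambda>t. f (t *\<^sub>R x)) has_field_derivative f' x) (at 1)"
    using has_derivative_bounded_linear[OF f]
    by (simp add: has_field_derivative_def linear_simps mult.commute[of _ "f' x"])
  moreover have "((\<lambda>t. f (t *\<^sub>R x)) has_field_derivative c * f x) (at 1)"
  proof (rule has_field_derivative_transform_within_open[of "\<lambda>t. t powr c * f x" _ _ "{0<..}"])
    show "((\<lambda>t. t powr c * f x) has_real_derivative c * f x) (at 1)"
      by (auto intro!: derivative_eq_intros)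
  qed (use hom in auto)
  ultimately show ?thesis by (rule DERIV_unique)
qed

lemma curve_first_derivative:
  assumes "(f has_derivative f') (at (X t))" and "(X has_vector_derivative W) (at t)"
  shows "((\<lambda>t. f (X t)) has_field_derivative f' W) (at t)"
  using has_derivative_compose[OF assms(2)[unfolded has_vector_derivative_def] assms(1)]
    has_derivative_bounded_linear[OF assms(1)]
  by (simp add: has_field_derivative_def linear_simps mult.commute[of _ "f' W"])

lemma curve_second_derivative:
  fixes f' :: "'v::real_normed_vector \<Rightarrow> 'v \<Rightarrow>\<^sub>L real"
  assumes "(f' has_derivative blinfun_apply f'') (at (X t))"
    and X: "(X has_vector_derivative W t) (at t)" and W: "(W has_vector_derivative V) (at t)"
  shows "((\<lambda>t. f' (X t) (W t)) has_field_derivative f'' (W t) (W t) + f' (X t) V) (at t)"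
proof -
  have 1: "((\<lambda>t. f' (X t)) has_derivative (\<lambda>r. f'' (r *\<^sub>R W t))) (at t)"
    by (rule has_derivative_compose[OF X[unfolded has_vector_derivative_def] assms(1)])
  have 2: "(W has_derivative (\<lambda>r. r *\<^sub>R V)) (at t)" using W by (simp add: has_vector_derivative_def)
  have "((\<lambda>t. f' (X t) (W t)) has_derivative (\<lambda>r. f' (X t) (r *\<^sub>R V) + f'' (r *\<^sub>R W t) (W t))) (at t)"
    by (rule bounded_bilinear.FDERIV[OF bounded_bilinear_blinfun_apply 1 2])
  moreover have "(\<lambda>r. f' (X t) (r *\<^sub>R V) + f'' (r *\<^sub>R W t) (W t))
      = (*) (f'' (W t) (W t) + f' (X t) V)"
    by (auto simp: blinfun.scaleR_right blinfun.scaleR_left algebra_simps)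
  ultimately show ?thesis by (simp add: has_field_derivative_def)
qed

lemma has_vector_derivative_vec_lambda:
  assumes "\<And>i. ((\<lambda>t. f t i) has_field_derivative f' i) (at t)"
  shows "((\<lambda>t. \<chi> i. f t i :: real ^ 'n::finite) has_vector_derivative (\<chi> i. f' i)) (at t)"
proof -
  have "(\<lambda>t. \<chi> i. f t i) = (\<lambda>t. \<Sum>i\<in>UNIV. f t i *\<^sub>R axis i 1)"
    using vec_eq_sum_axis[of "\<chi> i. f t i" for t] by auto
  moreover have "((\<lambda>t. \<Sum>i\<in>UNIV. f t i *\<^sub>R axis i 1) has_vector_derivative
     (\<Sum>i\<in>UNIV. f' i *\<^sub>R axis i (1::real))) (at t)"
    using assms by (auto intro!: derivative_eq_intros simp: has_real_derivative_iff_has_vector_derivative)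
  ultimately show ?thesis using vec_eq_sum_axis[of "\<chi> i. f' i"] by simp
qed

section \<open>The logarithm of a generating function\<close>

text \<open>The componentwise exponential, which maps onto the open positive orthant.\<close>
definition expv :: "real ^ 'n::finite \<Rightarrow> real ^ 'n" where
  "expv u = (\<chi> i. exp (u $ i))"

lemma expv_nth [simp]: "expv u $ i = exp (u $ i)" by (simp add: expv_def)
lemma expv_pos: "expv u \<in> pos_orthant" by (simp add: pos_orthant_def)

lemma pos_orthant_nonneg: "x \<in> pos_orthant \<Longrightarrow> x \<in> nonneg_orthant"
  by (simp add: pos_orthant_def nonneg_orthant_def less_imp_le)

lemma gev_mu_pos: "gev_generating \<mu> G \<Longrightarrow> 0 < \<mu>"
  by (simp add: gev_generating_def)

lemma gev_homogeneous:
  "gev_generating \<mu> G \<Longrightarrow> x \<in> pos_orthant \<Longrightarrow> t > 0 \<Longrightarrow> G (t *\<^sub>R x) = t powr (1 / \<mu>) * G x"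
  by (simp add: gev_generating_def pos_orthant_nonneg)

lemma gev_C2: "gev_generating \<mu> G \<Longrightarrow> C2_on G pos_orthant"
  by (simp add: gev_generating_def)

lemma gev_signs:
  assumes "gev_generating \<mu> G" "distinct js" "js \<noteq> []" "x \<in> pos_orthant"
  shows "odd (length js) \<Longrightarrow> 0 \<le> mixed_partial js G x"
    and "even (length js) \<Longrightarrow> mixed_partial js G x \<le> 0"
  using assms by (simp_all add: gev_generating_def)

text \<open>
  The last two properties are Euler's identity for \<open>G\<close> and its derivative in the direction \<open>v\<close>,
  that is, Euler's identity for the first partial derivatives.
\<close>
lemma gev_derivatives:
  fixes G :: "real ^ 'n::finite \<Rightarrow> real"
  assumes G: "gev_generating \<mu> G"
  obtains f' :: "real ^ 'n \<Rightarrow> (real ^ 'n) \<Rightarrow>\<^sub>L real" and f'' :: "real ^ 'n \<Rightarrow> (real ^ 'n) \<Rightarrow>\<^sub>L ((real ^ 'n) \<Rightarrow>\<^sub>L real)"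
  where "\<And>x. x \<in> pos_orthant \<Longrightarrow> (G has_derivative f' x) (at x)"
    and "\<And>x. x \<in> pos_orthant \<Longrightarrow> (f' has_derivative f'' x) (at x)"
    and "\<And>x i. x \<in> pos_orthant \<Longrightarrow> 0 \<le> f' x (axis i 1)"
    and "\<And>x i j. x \<in> pos_orthant \<Longrightarrow> i \<noteq> j \<Longrightarrow> f'' x (axis i 1) (axis j 1) \<le> 0"
    and "\<And>x i. x \<in> pos_orthant \<Longrightarrow> partial_deriv i (partial_deriv i G) x = f'' x (axis i 1) (axis i 1)"
    and "\<And>x. x \<in> pos_orthant \<Longrightarrow> f' x x = 1 / \<mu> * G x"
    and "\<And>x v. x \<in> pos_orthant \<Longrightarrow> f'' x v x = (1 / \<mu> - 1) * f' x v"
proof -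
  obtain f' :: "real ^ 'n \<Rightarrow> (real ^ 'n) \<Rightarrow>\<^sub>L real" and f'' :: "real ^ 'n \<Rightarrow> (real ^ 'n) \<Rightarrow>\<^sub>L ((real ^ 'n) \<Rightarrow>\<^sub>L real)"
    where f': "\<And>x. x \<in> pos_orthant \<Longrightarrow> (G has_derivative f' x) (at x)"
      and f'': "\<And>x. x \<in> pos_orthant \<Longrightarrow> (f' has_derivative f'' x) (at x)"
    using gev_C2[OF G] unfolding C2_on_def by blast
  have sgn: "(odd (length js) \<longrightarrow> 0 \<le> mixed_partial js G x) \<and> (even (length js) \<longrightarrow> mixed_partial js G x \<le> 0)"
    if "distinct js" "js \<noteq> []" "x \<in> pos_orthant" for js and x :: "real ^ 'n"
    using gev_signs[OF G that] by blast
  have d1: "partial_deriv i G x = f' x (axis i 1)" if "x \<in> pos_orthant" for x i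
    using partial_deriv_eq[OF f'[OF that]] .
  have f''_apply: "((\<lambda>y. f' y v) has_derivative (\<lambda>w. f'' x w v)) (at x)" if "x \<in> pos_orthant" for x v
    using bounded_linear.has_derivative[OF blinfun.bounded_linear_left f''[OF that]] .
  have d2: "partial_deriv i (partial_deriv j G) x = f'' x (axis i 1) (axis j 1)"
    if x: "x \<in> pos_orthant" for x i j
  proof -
    have "partial_deriv i (partial_deriv j G) x = partial_deriv i (\<lambda>y. f' y (axis j 1)) x"
      using open_pos_orthant x d1 by (rule partial_deriv_cong_open)
    also have "\<dots> = f'' x (axis i 1) (axis j 1)"
      using partial_deriv_eq[OF f''_apply[OF x]] .
    finally show ?thesis .
  qed
  have euler: "f' x x = 1 / \<mu> * G x" if x: "x \<in> pos_orthant" for x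
    using f'[OF x] gev_homogeneous[OF G x] by (rule euler_homogeneous)
  have euler2: "f'' x v x = (1 / \<mu> - 1) * f' x v" if x: "x \<in> pos_orthant" for x v
  proof -
    have 1: "((\<lambda>y. f' y y) has_derivative (\<lambda>v. f' x v + f'' x v x)) (at x)"
      by (rule bounded_bilinear.FDERIV[OF bounded_bilinear_blinfun_apply f''[OF x] has_derivative_ident])
    have 2: "((\<lambda>y. 1 / \<mu> * G y) has_derivative (\<lambda>v. 1 / \<mu> * f' x v)) (at x)"
      by (rule has_derivative_mult_right[OF f'[OF x]])
    have "((\<lambda>y. f' y y) has_derivative (\<lambda>v. 1 / \<mu> * f' x v)) (at x)"
      by (rule has_derivative_transform_within_open[OF 2 open_pos_orthant x]) (use euler in auto)
    from has_derivative_unique[OF 1 this]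
    have "f' x v + f'' x v x = 1 / \<mu> * f' x v" by (rule fun_cong)
    then show ?thesis by (simp add: algebra_simps)
  qed
  show ?thesis
  proof (rule that[OF f' f''])
    fix x :: "real ^ 'n" and i j :: 'n assume x: "x \<in> pos_orthant"
    show "0 \<le> f' x (axis i 1)"
      using sgn[of "[i]" x] x d1[OF x] by (simp add: mixed_partial_def)
    show "f'' x (axis i 1) (axis j 1) \<le> 0" if "i \<noteq> j"
      using sgn[of "[i, j]" x] x d2[OF x] that by (simp add: mixed_partial_def)
    show "partial_deriv i (partial_deriv i G) x = f'' x (axis i 1) (axis i 1)"
      using d2[OF x] .
      show "f' x x = 1 / \<mu> * G x" using euler[OF x] .
    show "f'' x v x = (1 / \<mu> - 1) * f' x v" for v using euler2[OF x] .
  qed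
qed

text \<open>
  The function \<open>\<mu> ln G(e\<^sup>u) + c\<close> is \<open>L\<close>-smooth with respect to the maximum norm: on each line,
  its difference from a suitable parabola is concave.
\<close>
lemma gev_log_smooth:
  fixes G :: "real ^ 'n::finite \<Rightarrow> real"
  assumes G: "gev_generating \<mu> G"
    and M: "\<And>x. x \<in> pos_orthant \<Longrightarrow>
           (\<Sum>i\<in>UNIV. partial_deriv i (partial_deriv i G) x * (x $ i)\<^sup>2) \<le> M * G x"
    and pos: "\<And>x. x \<in> pos_orthant \<Longrightarrow> 0 < G x"
    and E: "\<And>u. E u = \<mu> * ln (G (expv u)) + c"
    and L: "L = 2 * (\<mu> * M + 1) - 1 / \<mu>"
  shows "0 < L"
    and "\<lbrakk>\<And>i. \<bar>h $ i\<bar> \<le> s; 0 \<le> \<alpha>; \<alpha> \<le> 1\<rbrakk> \<Longrightarrow>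
       \<alpha> * E (u + (1 - \<alpha>) *\<^sub>R h) + (1 - \<alpha>) * E (u - \<alpha> *\<^sub>R h)
         \<le> E u + L / 2 * \<alpha> * (1 - \<alpha>) * s\<^sup>2"
proof -
  have \<mu>: "0 < \<mu>" using G by (rule gev_mu_pos)
  obtain f' :: "real ^ 'n \<Rightarrow> (real ^ 'n) \<Rightarrow>\<^sub>L real" and f'' :: "real ^ 'n \<Rightarrow> (real ^ 'n) \<Rightarrow>\<^sub>L ((real ^ 'n) \<Rightarrow>\<^sub>L real)"
  where f': "\<And>x. x \<in> pos_orthant \<Longrightarrow> (G has_derivative f' x) (at x)"
    and f'': "\<And>x. x \<in> pos_orthant \<Longrightarrow> (f' has_derivative f'' x) (at x)"
    and f'_nonneg: "\<And>x i. x \<in> pos_orthant \<Longrightarrow> 0 \<le> f' x (axis i 1)"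
    and f''_off: "\<And>x i j. x \<in> pos_orthant \<Longrightarrow> i \<noteq> j \<Longrightarrow> f'' x (axis i 1) (axis j 1) \<le> 0"
    and f''_diag: "\<And>x i. x \<in> pos_orthant \<Longrightarrow> partial_deriv i (partial_deriv i G) x = f'' x (axis i 1) (axis i 1)"
    and euler: "\<And>x. x \<in> pos_orthant \<Longrightarrow> f' x x = 1 / \<mu> * G x"
    and euler2: "\<And>x v. x \<in> pos_orthant \<Longrightarrow> f'' x v x = (1 / \<mu> - 1) * f' x v"
    by (rule gev_derivatives[OF G], rule that)
  define A where "A x i j = x $ i * x $ j * f'' x (axis i 1) (axis j 1)" for x i j
  define d where "d x i = x $ i * f' x (axis i 1)" for x i
  have bl: "blinfun_apply B v = (\<Sum>i\<in>UNIV. v $ i *\<^sub>R B (axis i 1))"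
    for B :: "(real ^ 'n) \<Rightarrow>\<^sub>L 'z::real_normed_vector" and v
    by (rule linear_vec_sum) (rule blinfun.bounded_linear_right)
  have d_nonneg: "0 \<le> d x i" if "x \<in> pos_orthant" for x i
    using f'_nonneg[OF that] that by (simp add: d_def pos_orthant_def less_imp_le)
  have A_off: "A x i j \<le> 0" if "x \<in> pos_orthant" "i \<noteq> j" for x i j
    using f''_off[OF that] that by (simp add: A_def pos_orthant_def mult_nonneg_nonpos less_imp_le)
  have A_row: "(\<Sum>j\<in>UNIV. A x i j) = (1 / \<mu> - 1) * d x i" if x: "x \<in> pos_orthant" for x i
  proof -
    have "(\<Sum>j\<in>UNIV. A x i j) = x $ i * f'' x (axis i 1) x"
      using bl[of "f'' x (axis i 1)" x] by (simp add: A_def sum_distrib_left mult.assoc)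
    then show ?thesis using euler2[OF x] by (simp add: d_def)
  qed
  have d_sum: "(\<Sum>i\<in>UNIV. d x i) = 1 / \<mu> * G x" if x: "x \<in> pos_orthant" for x
  proof -
    have "(\<Sum>i\<in>UNIV. d x i) = f' x x" using bl[of "f' x" x] by (simp add: d_def)
    then show ?thesis using euler[OF x] by simp
  qed
  have A_diag: "(\<Sum>i\<in>UNIV. A x i i) \<le> M * G x" if x: "x \<in> pos_orthant" for x
    using M[OF x] by (simp add: A_def f''_diag[OF x] power2_eq_square mult_ac)
  show L_pos: "0 < L"
  proof -
    \<comment> \<open>Any point of the orthant serves to bound \<open>M\<close> from below.\<close>
    define x where "x = expv (0 :: real ^ 'n)"
    have x: "x \<in> pos_orthant" by (simp add: x_def expv_pos)
    have "(1 / \<mu> - 1) * (\<Sum>i\<in>UNIV. d x i) \<le> (\<Sum>i\<in>UNIV. A x i i)"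
      using A_off[OF x] A_row[OF x] by (intro diagonal_lower_bound) auto
    then have "(1 / \<mu> - 1) * (1 / \<mu> * G x) \<le> M * G x"
      using A_diag[OF x] unfolding d_sum[OF x] by linarith
    then have "(1 / \<mu> - 1) * (1 / \<mu>) * G x \<le> M * G x" by (simp only: mult.assoc)
    then have "(1 / \<mu> - 1) * (1 / \<mu>) \<le> M" using pos[OF x] by (rule mult_right_le_imp_le)
    then have "\<mu> * ((1 / \<mu> - 1) * (1 / \<mu>)) \<le> \<mu> * M" using \<mu> by (intro mult_left_mono) auto
    then have "1 / \<mu> \<le> \<mu> * M + 1" using \<mu> by (simp add: left_diff_distrib)
    moreover have "0 < 1 / \<mu>" using \<mu> by simp
    moreover have "0 < b \<Longrightarrow> b \<le> a \<Longrightarrow> 0 < 2 * a - b" for a b :: real by linarith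
    ultimately show ?thesis unfolding L by blast
  qed
  assume h: "\<And>i. \<bar>h $ i\<bar> \<le> s" and \<alpha>: "0 \<le> \<alpha>" "\<alpha> \<le> 1"
  define X where "X t = expv (u + t *\<^sub>R h)" for t
  define W where "W t = (\<chi> i. X t $ i * h $ i)" for t
  define V where "V t = (\<chi> i. X t $ i * (h $ i)\<^sup>2)" for t
  have X_pos: "X t \<in> pos_orthant" for t by (simp add: X_def expv_pos)
  have X': "(X has_vector_derivative W t) (at t)" for t
    unfolding X_def W_def expv_def
    by (rule has_vector_derivative_vec_lambda) (auto intro!: derivative_eq_intros simp: mult_ac)
  have W': "(W has_vector_derivative V t) (at t)" for t
    unfolding X_def W_def V_def expv_def
    by (rule has_vector_derivative_vec_lambda)
       (auto intro!: derivative_eq_intros simp: mult_ac power2_eq_square)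
  define g where "g t = G (X t)" for t
  define g' where "g' t = f' (X t) (W t)" for t
  define g'' where "g'' t = f'' (X t) (W t) (W t) + f' (X t) (V t)" for t
  have g_pos: "0 < g t" for t using pos[OF X_pos] by (simp add: g_def)
  have g1: "(g has_real_derivative g' t) (at t)" for t
    unfolding g_def g'_def by (rule curve_first_derivative[OF f'[OF X_pos] X'])
  have g2: "(g' has_real_derivative g'' t) (at t)" for t
    unfolding g'_def g''_def by (rule curve_second_derivative[OF f''[OF X_pos] X' W'])
  have g2_bound: "\<mu> * g'' t \<le> L * s\<^sup>2 * g t" for t
  proof -
    have 1: "f'' (X t) (W t) (W t) = (\<Sum>i\<in>UNIV. \<Sum>j\<in>UNIV. A (X t) i j * h $ i * h $ j)"
    proof -
      have "f'' (X t) (W t) (W t) = (\<Sum>i\<in>UNIV. W t $ i * f'' (X t) (axis i 1) (W t))"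
        using bl[of "f'' (X t)" "W t"] by (simp add: blinfun.sum_left blinfun.scaleR_left)
      also have "\<dots> = (\<Sum>i\<in>UNIV. W t $ i * (\<Sum>j\<in>UNIV. W t $ j * f'' (X t) (axis i 1) (axis j 1)))"
        using bl[of "f'' (X t) (axis i 1)" "W t" for i] by simp
      finally show ?thesis by (simp add: A_def W_def sum_distrib_left mult_ac)
    qed
    have 2: "f' (X t) (V t) = (\<Sum>i\<in>UNIV. d (X t) i * (h $ i)\<^sup>2)"
      using bl[of "f' (X t)" "V t"] by (simp add: V_def d_def mult_ac)
    have "g'' t \<le> s\<^sup>2 * (2 * (\<Sum>i\<in>UNIV. A (X t) i i) + (2 - 1 / \<mu>) * (\<Sum>i\<in>UNIV. d (X t) i))"
      unfolding g''_def 1 2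
      using d_nonneg[OF X_pos] A_off[OF X_pos] A_row[OF X_pos] h \<mu>
      by (intro quadratic_form_bound) auto
    also have "\<dots> \<le> s\<^sup>2 * (2 * (M * g t) + (2 - 1 / \<mu>) * (1 / \<mu> * g t))"
      using A_diag[OF X_pos[of t]] unfolding d_sum[OF X_pos] g_def by (intro mult_left_mono) auto
    finally have "\<mu> * g'' t \<le> \<mu> * (s\<^sup>2 * (2 * (M * g t) + (2 - 1 / \<mu>) * (1 / \<mu> * g t)))"
      using \<mu> by (intro mult_left_mono) auto
    also have "\<dots> = (2 * (\<mu> * M) + (2 - 1 / \<mu>) * (\<mu> * (1 / \<mu>))) * s\<^sup>2 * g t"
      by (simp only: distrib_left distrib_right mult_ac)
    also have "\<dots> = L * s\<^sup>2 * g t" using \<mu> by (simp add: L)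
    finally show ?thesis .
  qed
  define \<psi> where "\<psi> t = L * s\<^sup>2 / 2 * t\<^sup>2 - \<mu> * ln (g t)" for t
  have "convex_on UNIV \<psi>"
  proof (rule f''_ge0_imp_convex[where f' = "\<lambda>t. L * s\<^sup>2 * t - \<mu> * (g' t / g t)"
        and f'' = "\<lambda>t. L * s\<^sup>2 - \<mu> * ((g'' t * g t - g' t * g' t) / (g t * g t))"])
    show "(\<psi> has_real_derivative L * s\<^sup>2 * t - \<mu> * (g' t / g t)) (at t)" for t
      unfolding \<psi>_def using g_pos[of t] by (auto intro!: derivative_eq_intros g1)
    show "((\<lambda>t. L * s\<^sup>2 * t - \<mu> * (g' t / g t)) has_real_derivative
        L * s\<^sup>2 - \<mu> * ((g'' t * g t - g' t * g' t) / (g t * g t))) (at t)" for t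
      using g_pos[of t] by (auto intro!: derivative_eq_intros g1 g2 simp: algebra_simps)
    show "0 \<le> L * s\<^sup>2 - \<mu> * ((g'' t * g t - g' t * g' t) / (g t * g t))" for t
    proof -
      have "(g'' t * g t - g' t * g' t) / (g t * g t) \<le> g'' t / g t"
        (is "?l \<le> _")
      proof -
        have "?l = g'' t / g t - (g' t / g t)\<^sup>2"
          using g_pos[of t] by (simp add: diff_divide_distrib power2_eq_square)
        then show ?thesis by simp
      qed
      then have "\<mu> * ((g'' t * g t - g' t * g' t) / (g t * g t)) \<le> \<mu> * (g'' t / g t)"
        using \<mu> by (intro mult_left_mono) auto
      also have "\<dots> \<le> L * s\<^sup>2" using g2_bound[of t] g_pos[of t] by (simp add: field_simps)
      finally show ?thesis by simp
    qed
  qed auto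
  from convex_onD[OF this, of \<alpha> "- \<alpha>" "1 - \<alpha>"]
  have conv: "\<psi> 0 \<le> (1 - \<alpha>) * \<psi> (- \<alpha>) + \<alpha> * \<psi> (1 - \<alpha>)"
    using \<alpha> by (simp add: algebra_simps)
  have E_\<psi>: "E (u + t *\<^sub>R h) = L * s\<^sup>2 / 2 * t\<^sup>2 - \<psi> t + c" for t
    by (simp add: E \<psi>_def g_def X_def)
  have E3: "E (u + (1 - \<alpha>) *\<^sub>R h) = L * s\<^sup>2 / 2 * (1 - \<alpha>)\<^sup>2 - \<psi> (1 - \<alpha>) + c"
    "E (u - \<alpha> *\<^sub>R h) = L * s\<^sup>2 / 2 * \<alpha>\<^sup>2 - \<psi> (- \<alpha>) + c" "E u = - \<psi> 0 + c"
    using E_\<psi>[of "1 - \<alpha>"] E_\<psi>[of "- \<alpha>"] E_\<psi>[of 0] by simp_all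
  have "\<alpha> * E (u + (1 - \<alpha>) *\<^sub>R h) + (1 - \<alpha>) * E (u - \<alpha> *\<^sub>R h)
      = L / 2 * \<alpha> * (1 - \<alpha>) * s\<^sup>2 - ((1 - \<alpha>) * \<psi> (- \<alpha>) + \<alpha> * \<psi> (1 - \<alpha>)) + c"
    unfolding E3 by (simp add: power2_eq_square field_simps)
  then show "\<alpha> * E (u + (1 - \<alpha>) *\<^sub>R h) + (1 - \<alpha>) * E (u - \<alpha> *\<^sub>R h)
         \<le> E u + L / 2 * \<alpha> * (1 - \<alpha>) * s\<^sup>2"
    using conv E3(3) by linarith
qed

section \<open>Mixed partial derivatives of the distribution function\<close>

text \<open>
  An algebra of functions of \<open>y\<close> that contains all derivatives of \<open>F(y) = exp (- G(e\<^bsup>-y\<^esup>))\<close> taken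
  at most once in each variable of \<open>S\<close> and in no other. Its elements can be differentiated in any
  variable outside \<open>S\<close>, as every mixed partial of \<open>G\<close> occurring in them involves only distinct
  variables from \<open>S\<close>.
\<close>
inductive cdf_algebra :: "(real ^ 'n::finite \<Rightarrow> real) \<Rightarrow> 'n set \<Rightarrow> (real ^ 'n \<Rightarrow> real) \<Rightarrow> bool"
  for G where
  const: "cdf_algebra G S (\<lambda>y. c)"
| exp_coord: "j \<in> S \<Longrightarrow> cdf_algebra G S (\<lambda>y. exp (- (y $ j)))"
| cdf: "cdf_algebra G S (\<lambda>y. exp (- G (expv (- y))))"
| partial: "distinct ks \<Longrightarrow> set ks \<subseteq> S \<Longrightarrow> cdf_algebra G S (\<lambda>y. mixed_partial ks G (expv (- y)))"
| add: "cdf_algebra G S f \<Longrightarrow> cdf_algebra G S g \<Longrightarrow> cdf_algebra G S (\<lambda>y. f y + g y)"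
| mult: "cdf_algebra G S f \<Longrightarrow> cdf_algebra G S g \<Longrightarrow> cdf_algebra G S (\<lambda>y. f y * g y)"

lemma cdf_algebra_mono: "cdf_algebra G S f \<Longrightarrow> S \<subseteq> T \<Longrightarrow> cdf_algebra G T f"
  by (induction rule: cdf_algebra.induct) (auto intro: cdf_algebra.intros)

lemma partially_differentiable_atD:
  "partially_differentiable_at i f x \<Longrightarrow>
    ((\<lambda>t. f (x + t *\<^sub>R axis i 1)) has_real_derivative partial_deriv i f x) (at 0)"
  by (simp add: partially_differentiable_at_def partial_deriv_def DERIV_deriv_iff_field_differentiable)

lemma partially_differentiable_atI:
  "((\<lambda>t. f (x + t *\<^sub>R axis i 1)) has_real_derivative D) (at 0) \<Longrightarrow>
     partially_differentiable_at i f x \<and> partial_deriv i f x = D"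
  by (auto simp: partially_differentiable_at_def partial_deriv_def field_differentiable_def
      intro: DERIV_imp_deriv)

lemma mixed_partial_Cons: "mixed_partial (i # js) f = partial_deriv i (mixed_partial js f)"
  by (simp add: mixed_partial_def fun_eq_iff)

lemma mixed_partial_Nil [simp]: "mixed_partial [] f = f"
  by (simp add: mixed_partial_def)

lemma expv_uminus_shift:
  "expv (- (y + t *\<^sub>R axis i 1)) = expv (- y) + (exp (- (y $ i)) * (exp (- t) - 1)) *\<^sub>R axis i 1"
  by (auto simp: vec_eq_iff axis_def exp_add[symmetric] algebra_simps)

lemma gev_partially_differentiable:
  "gev_generating \<mu> G \<Longrightarrow> distinct (i # js) \<Longrightarrow> x \<in> pos_orthant \<Longrightarrow>
     partially_differentiable_at i (mixed_partial js G) x"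
  unfolding gev_generating_def by blast

lemma cdf_algebra_deriv:
  assumes G: "gev_generating \<mu> G" and "cdf_algebra G S f" and "i \<notin> S"
  shows "\<exists>f'. cdf_algebra G (insert i S) f' \<and>
    (\<forall>y. ((\<lambda>t. f (y + t *\<^sub>R axis i 1)) has_real_derivative f' y) (at 0))"
proof -
  have gpart: "((\<lambda>t. mixed_partial ks G (expv (- (y + t *\<^sub>R axis i 1)))) has_real_derivative
      mixed_partial (i # ks) G (expv (- y)) * (- 1 * exp (- (y $ i)))) (at 0)"
    if "distinct (i # ks)" for ks y
  proof -
    have "((\<lambda>t. exp (- (y $ i)) * (exp (- t) - 1)) has_real_derivative (- 1 * exp (- (y $ i)))) (at 0)"
      by (auto intro!: derivative_eq_intros)
    moreover have "((\<lambda>t. mixed_partial ks G (expv (- y) + t *\<^sub>R axis i 1)) has_real_derivative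
        mixed_partial (i # ks) G (expv (- y))) (at (exp (- (y $ i)) * (exp (- 0) - 1)))"
      using partially_differentiable_atD[OF gev_partially_differentiable[OF G that expv_pos]]
      by (simp add: mixed_partial_Cons)
    ultimately show ?thesis unfolding expv_uminus_shift by (rule DERIV_chain2[rotated])
  qed
  from assms(2,3) show ?thesis
  proof (induction rule: cdf_algebra.induct)
    case (const S c)
    show ?case by (intro exI[of _ "\<lambda>y. 0"] conjI cdf_algebra.const) auto
  next
    case (exp_coord j S)
    then have "axis i (1 :: real) $ j = 0" by (auto simp: axis_def)
    then show ?case by (intro exI[of _ "\<lambda>y. 0"] conjI cdf_algebra.const) auto
  next
    case (cdf S)
    show ?case
    proof (intro exI conjI allI)
      show "((\<lambda>t. exp (- G (expv (- (y + t *\<^sub>R axis i 1))))) has_real_derivative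
          exp (- G (expv (- y))) * (mixed_partial [i] G (expv (- y)) * exp (- (y $ i)))) (at 0)" for y
        using gpart[of "[]" y] by (auto intro!: derivative_eq_intros)
      show "cdf_algebra G (insert i S) (\<lambda>y. exp (- G (expv (- y))) *
          (mixed_partial [i] G (expv (- y)) * exp (- (y $ i))))"
        by (intro cdf_algebra.mult cdf_algebra.cdf cdf_algebra.partial cdf_algebra.exp_coord) auto
    qed
  next
    case (partial ks S)
    then have d: "distinct (i # ks)" by auto
    have "cdf_algebra G (insert i S)
        (\<lambda>y. mixed_partial (i # ks) G (expv (- y)) * (- 1 * exp (- (y $ i))))"
      using partial d
      by (intro cdf_algebra.mult cdf_algebra.const cdf_algebra.partial cdf_algebra.exp_coord) auto
    with gpart[OF d] show ?case by blast
  next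
    case (add S f g)
    then obtain f' g' where 1: "cdf_algebra G (insert i S) f'" "cdf_algebra G (insert i S) g'"
      and 2: "\<forall>y. ((\<lambda>t. f (y + t *\<^sub>R axis i 1)) has_real_derivative f' y) (at 0)"
       "\<forall>y. ((\<lambda>t. g (y + t *\<^sub>R axis i 1)) has_real_derivative g' y) (at 0)" by blast
    show ?case
    proof (intro exI conjI allI)
      show "cdf_algebra G (insert i S) (\<lambda>y. f' y + g' y)" using 1 by (rule cdf_algebra.add)
      show "((\<lambda>t. f (y + t *\<^sub>R axis i 1) + g (y + t *\<^sub>R axis i 1)) has_real_derivative f' y + g' y) (at 0)"
        for y using 2 by (intro DERIV_add) auto
    qed
  next
    case (mult S f g)
    then obtain f' g' where 1: "cdf_algebra G (insert i S) f'" "cdf_algebra G (insert i S) g'"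
      and 2: "\<forall>y. ((\<lambda>t. f (y + t *\<^sub>R axis i 1)) has_real_derivative f' y) (at 0)"
       "\<forall>y. ((\<lambda>t. g (y + t *\<^sub>R axis i 1)) has_real_derivative g' y) (at 0)" by blast
    have 3: "cdf_algebra G (insert i S) f" "cdf_algebra G (insert i S) g"
      using mult.hyps cdf_algebra_mono by blast+
    show ?case
    proof (intro exI conjI allI)
      show "cdf_algebra G (insert i S) (\<lambda>y. f' y * g y + g' y * f y)"
        using 1 3 by (intro cdf_algebra.add cdf_algebra.mult)
      show "((\<lambda>t. f (y + t *\<^sub>R axis i 1) * g (y + t *\<^sub>R axis i 1)) has_real_derivative
          f' y * g y + g' y * f y) (at 0)" for y
        using DERIV_mult[OF 2(1)[rule_format, of y] 2(2)[rule_format, of y]] by simp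
    qed
  qed
qed

text \<open>
  All the derivatives taken when forming \<open>mixed_partial js f\<close> exist everywhere. The head of the
  list is the variable of the last differentiation.
\<close>
primrec has_partials :: "'n::finite list \<Rightarrow> (real ^ 'n \<Rightarrow> real) \<Rightarrow> bool" where
  "has_partials [] f = True"
| "has_partials (i # js) f \<longleftrightarrow>
     has_partials js f \<and> (\<forall>y. partially_differentiable_at i (mixed_partial js f) y)"

lemma gev_cdf_partials:
  assumes G: "gev_generating \<mu> G" and "distinct js"
  shows "has_partials js (\<lambda>y. exp (- G (expv (- y)))) \<and>
    cdf_algebra G (set js) (mixed_partial js (\<lambda>y. exp (- G (expv (- y)))))"
  using assms(2)
proof (induction js)
  case Nil
  show ?case by (simp add: cdf_algebra.cdf)
next
  case (Cons i js)
  let ?F = "\<lambda>y. exp (- G (expv (- y)))"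
  have IH: "has_partials js ?F" "cdf_algebra G (set js) (mixed_partial js ?F)" using Cons by auto
  obtain f' where f': "cdf_algebra G (insert i (set js)) f'"
    "\<And>y. ((\<lambda>t. mixed_partial js ?F (y + t *\<^sub>R axis i 1)) has_real_derivative f' y) (at 0)"
    using cdf_algebra_deriv[OF G IH(2), of i] Cons.prems by auto
  have "partially_differentiable_at i (mixed_partial js ?F) y \<and> partial_deriv i (mixed_partial js ?F) y = f' y" for y
    by (rule partially_differentiable_atI[OF f'(2)])
  moreover from this have "mixed_partial (i # js) ?F = f'" by (simp add: mixed_partial_Cons fun_eq_iff)
  ultimately show ?case using IH f'(1) by simp
qed

section \<open>Integrating a nonnegative mixed partial derivative over a box\<close>

text \<open>The vector \<open>z\<close> with its \<open>j\<close>-th coordinate replaced by \<open>c\<close>.\<close>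
definition upd :: "'n::finite \<Rightarrow> real \<Rightarrow> real ^ 'n \<Rightarrow> real ^ 'n" where
  "upd j c z = (\<chi> i. if i = j then c else z $ i)"

lemma upd_nth: "upd j c z $ i = (if i = j then c else z $ i)" by (simp add: upd_def)

lemma upd_same [simp]: "upd j (z $ j) z = z" by (simp add: vec_eq_iff upd_nth)

lemma upd_commute: "i \<noteq> j \<Longrightarrow> upd i c (upd j d z) = upd j d (upd i c z)"
  by (auto simp: vec_eq_iff upd_nth)

lemma upd_add_axis: "i \<noteq> j \<Longrightarrow> upd j c (y + t *\<^sub>R axis i 1) = upd j c y + t *\<^sub>R axis i 1"
  by (auto simp: vec_eq_iff upd_nth axis_def)

lemma upd_axis: "upd j c y + t *\<^sub>R axis j 1 = upd j (c + t) y"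
  by (auto simp: vec_eq_iff upd_nth axis_def)

text \<open>
  The iterated difference of \<open>H\<close> at \<open>z\<close> between \<open>a\<^sub>j\<close> and \<open>b\<^sub>j\<close> for each coordinate \<open>j\<close> in the list,
  which is the alternating sum of \<open>H\<close> over the corners of a box. It does not depend on the
  coordinates of \<open>z\<close> in the list.
\<close>
primrec box_diff :: "'n::finite list \<Rightarrow> real ^ 'n \<Rightarrow> real ^ 'n \<Rightarrow> (real ^ 'n \<Rightarrow> real) \<Rightarrow> real ^ 'n \<Rightarrow> real" where
  "box_diff [] a b H z = H z"
| "box_diff (j # js) a b H z = box_diff js a b (\<lambda>y. H (upd j (b $ j) y) - H (upd j (a $ j) y)) z"

lemma mixed_partial_slice_diff:
  assumes "has_partials ks H" and "j \<notin> set ks"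
  shows "has_partials ks (\<lambda>y. H (upd j c y) - H (upd j d y)) \<and>
    mixed_partial ks (\<lambda>y. H (upd j c y) - H (upd j d y))
      = (\<lambda>y. mixed_partial ks H (upd j c y) - mixed_partial ks H (upd j d y))"
  using assms
proof (induction ks)
  case (Cons i ks)
  let ?D = "\<lambda>y. H (upd j c y) - H (upd j d y)" and ?K = "mixed_partial ks H"
  have IH: "has_partials ks ?D" "mixed_partial ks ?D = (\<lambda>y. ?K (upd j c y) - ?K (upd j d y))"
    using Cons by auto
  have ij: "i \<noteq> j" using Cons.prems by auto
  have K: "((\<lambda>t. ?K (y + t *\<^sub>R axis i 1)) has_real_derivative partial_deriv i ?K y) (at 0)" for y
    using Cons.prems by (auto intro: partially_differentiable_atD)
  have "((\<lambda>t. mixed_partial ks ?D (y + t *\<^sub>R axis i 1)) has_real_derivative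
      partial_deriv i ?K (upd j c y) - partial_deriv i ?K (upd j d y)) (at 0)" for y
    unfolding IH(2) upd_add_axis[OF ij] by (intro DERIV_diff K)
  from partially_differentiable_atI[OF this] show ?case
    using IH(1) by (simp add: mixed_partial_Cons fun_eq_iff)
qed simp

lemma DERIV_along_axis:
  assumes "\<And>y. partially_differentiable_at j K y"
  shows "((\<lambda>t. K (upd j t w)) has_real_derivative partial_deriv j K (upd j t w)) (at t)"
proof -
  have "((\<lambda>s. K (upd j (t + s) w)) has_real_derivative partial_deriv j K (upd j t w)) (at 0)"
    using partially_differentiable_atD[OF assms, of "upd j t w"] by (simp add: upd_axis)
  then show ?thesis
    using DERIV_shift[of "\<lambda>t. K (upd j t w)" "partial_deriv j K (upd j t w)" 0 t] by (simp add: add.commute)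
qed

lemma borel_measurable_vec_lambda:
  fixes f :: "'a \<Rightarrow> 'n::finite \<Rightarrow> real"
  assumes "\<And>i. (\<lambda>x. f x i) \<in> borel_measurable M"
  shows "(\<lambda>x. \<chi> i. f x i) \<in> borel_measurable M"
proof (subst borel_measurable_euclidean_space, intro ballI)
  fix b :: "real ^ 'n" assume "b \<in> Basis"
  then obtain i where "b = axis i 1" by (auto simp: Basis_vec_def)
  then show "(\<lambda>x. (\<chi> i. f x i) \<bullet> b) \<in> borel_measurable M" using assms by (simp add: inner_axis)
qed

lemma measurable_upd [measurable]: "(\<lambda>(z, t). upd j t z) \<in> borel_measurable (borel \<Otimes>\<^sub>M borel)"
  unfolding upd_def split_def by (rule borel_measurable_vec_lambda) measurable

text \<open>
  The vector whose coordinates in \<open>J\<close> are given by \<open>x\<close> and the others by \<open>z\<close>; it carries the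
  integration variables of a product measure over \<open>J\<close> into the ambient space.
\<close>
definition overlay :: "'n::finite set \<Rightarrow> ('n \<Rightarrow> real) \<Rightarrow> real ^ 'n \<Rightarrow> real ^ 'n" where
  "overlay J x z = (\<chi> i. if i \<in> J then x i else z $ i)"

lemma overlay_insert: "overlay (insert j J) (x(j := t)) z = upd j t (overlay J x z)"
  by (auto simp: vec_eq_iff overlay_def upd_nth)

lemma measurable_overlay [measurable]:
  "(\<lambda>x. overlay J x z) \<in> borel_measurable (\<Pi>\<^sub>M j\<in>J. lborel)"
  unfolding overlay_def
proof (rule borel_measurable_vec_lambda)
  show "(\<lambda>x. if i \<in> J then x i else z $ i) \<in> borel_measurable (\<Pi>\<^sub>M j\<in>J. lborel)" for i
  proof (cases "i \<in> J")
    case True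
    then have "(\<lambda>x. x i) \<in> measurable (\<Pi>\<^sub>M j\<in>J. lborel) (lborel :: real measure)"
      by (rule measurable_component_singleton)
    with True show ?thesis by simp
  qed simp
qed

text \<open>Lebesgue measure as a product measure indexed by coordinates rather than by basis vectors.\<close>
lemma lborel_vec_eq:
  "(lborel :: (real ^ 'n::finite) measure) = distr (\<Pi>\<^sub>M i\<in>UNIV. lborel) borel (\<lambda>x. \<chi> i. x i)"
proof (rule lborel_eqI)
  interpret product_sigma_finite "\<lambda>i :: 'n. lborel :: real measure" by standard
  fix l u :: "real ^ 'n" assume "\<And>b. b \<in> Basis \<Longrightarrow> l \<bullet> b \<le> u \<bullet> b"
  from this[of "axis i 1" for i] have lu: "l $ i \<le> u $ i" for i by (simp add: inner_axis)
  have meas: "(\<lambda>x. \<chi> i. x i) \<in> borel_measurable (\<Pi>\<^sub>M i\<in>UNIV::'n set. lborel :: real measure)"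
    using measurable_overlay[of UNIV 0] by (simp add: overlay_def)
  have "emeasure (distr (\<Pi>\<^sub>M i\<in>UNIV. lborel) borel (\<lambda>x. \<chi> i. x i)) (box l u)
      = emeasure (\<Pi>\<^sub>M i\<in>UNIV. lborel) (\<Pi>\<^sub>E i\<in>UNIV. {l $ i<..<u $ i})"
    by (subst emeasure_distr[OF meas]) (auto intro!: arg_cong2[where f = emeasure] simp: space_PiM mem_box_cart PiE_def Pi_def)
  also have "\<dots> = (\<Prod>i\<in>UNIV. ennreal (u $ i - l $ i))"
    by (subst emeasure_PiM) (auto simp: lu)
  also have "\<dots> = ennreal (\<Prod>i\<in>UNIV. u $ i - l $ i)"
    using lu by (intro prod_ennreal) auto
  also have "(\<Prod>i\<in>UNIV. u $ i - l $ i) = (\<Prod>b\<in>Basis. (u - l) \<bullet> b)"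
    by (simp add: Basis_vec_def UNION_singleton_eq_range prod.reindex inj_on_def axis_eq_axis inner_axis)
  finally show "emeasure (distr (\<Pi>\<^sub>M i\<in>UNIV. lborel) borel (\<lambda>x. \<chi> i. x i)) (box l u)
    = ennreal (\<Prod>b\<in>Basis. (u - l) \<bullet> b)" .
qed simp

text \<open>
  The induction integrates the outermost derivative first: by the fundamental theorem of calculus
  the result is \<open>mixed_partial js\<close> of the slice difference \<open>D\<close> of \<open>H\<close>, to which the hypotheses
  carry over. Nonnegativity of the box difference is part of the conclusion because \<open>ennreal\<close>
  truncates negative values.
\<close>
lemma nn_integral_mixed_partial_box:
  fixes z :: "real ^ 'n::finite"
  assumes "distinct js" "has_partials js H" "\<And>y. 0 \<le> mixed_partial js H y"
    "mixed_partial js H \<in> borel_measurable borel" "\<And>i. i \<in> set js \<Longrightarrow> a $ i \<le> b $ i"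
  shows "(\<integral>\<^sup>+x. ennreal (mixed_partial js H (overlay (set js) x z)) *
      (\<Prod>i\<in>set js. indicator {a $ i..b $ i} (x i)) \<partial>(\<Pi>\<^sub>M i\<in>set js. lborel))
    = ennreal (box_diff js a b H z) \<and> 0 \<le> box_diff js a b H z"
  using assms
proof (induction js arbitrary: H)
  case Nil
  interpret product_sigma_finite "\<lambda>i. lborel :: real measure" by standard
  show ?case using Nil(3)[of z] by (simp add: PiM_empty nn_integral_count_space_finite overlay_def)
next
  case (Cons j js)
  interpret product_sigma_finite "\<lambda>i. lborel :: real measure" by standard
  define K where "K = mixed_partial js H"
  define f where "f = mixed_partial (j # js) H"
  define D where "D = (\<lambda>y. H (upd j (b $ j) y) - H (upd j (a $ j) y))"
  have f: "f = partial_deriv j K" by (simp add: f_def K_def mixed_partial_Cons)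
  have [measurable]: "f \<in> borel_measurable borel" using Cons.prems by (simp add: f_def)
  have f_nonneg: "0 \<le> f y" for y using Cons.prems by (simp add: f_def)
  have j: "j \<notin> set js" and dist: "distinct js" and ab: "a $ j \<le> b $ j" using Cons.prems by auto
  have K': "((\<lambda>t. K (upd j t w)) has_real_derivative f (upd j t w)) (at t)" for t w
    unfolding f using Cons.prems by (intro DERIV_along_axis) (auto simp: K_def)
  have D: "has_partials js D" "mixed_partial js D = (\<lambda>w. K (upd j (b $ j) w) - K (upd j (a $ j) w))"
    using mixed_partial_slice_diff[OF _ j, of H "b $ j" "a $ j"] Cons.prems by (auto simp: D_def K_def)
  have FTC: "(\<integral>\<^sup>+t. ennreal (f (upd j t w)) * indicator {a $ j..b $ j} t \<partial>lborel)
      = ennreal (mixed_partial js D w)" for w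
  proof -
    have "(\<lambda>t. f (upd j t w)) \<in> borel_measurable borel" by measurable
    then show ?thesis unfolding D(2) using K' f_nonneg ab by (intro nn_integral_FTC_Icc) auto
  qed
  have D_nonneg: "0 \<le> mixed_partial js D w" for w
  proof -
    have "K (upd j (a $ j) w) \<le> K (upd j (b $ j) w)"
    proof (rule DERIV_nonneg_imp_nondecreasing[OF ab])
      fix t
      show "\<exists>y. ((\<lambda>t. K (upd j t w)) has_real_derivative y) (at t) \<and> 0 \<le> y"
        using K'[of w t] f_nonneg[of "upd j t w"] by (intro exI conjI)
    qed
    then show ?thesis by (simp add: D(2))
  qed
  \<comment> \<open>Measurability of \<open>D\<close>'s mixed partial is inherited from the inner integral by Fubini.\<close>
  have "(\<lambda>w. \<integral>\<^sup>+t. ennreal (f (upd j t w)) * indicator {a $ j..b $ j} t \<partial>lborel) \<in> borel_measurable borel"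
    by measurable
  then have "(\<lambda>w. ennreal (mixed_partial js D w)) \<in> borel_measurable borel" unfolding FTC .
  then have "(\<lambda>w. enn2real (ennreal (mixed_partial js D w))) \<in> borel_measurable borel" by measurable
  then have D_meas: "mixed_partial js D \<in> borel_measurable borel" using D_nonneg by simp
  let ?P = "\<lambda>x. \<Prod>i\<in>set js. indicator {a $ i..b $ i} (x i) :: ennreal"
  have P_upd: "(\<Prod>i\<in>set (j # js). indicator {a $ i..b $ i} ((x(j := t)) i) :: ennreal)
      = indicator {a $ j..b $ j} t * ?P x" for x t
  proof -
    have "?P (x(j := t)) = ?P x" using j by (intro prod.cong) auto
    then show ?thesis using j by simp
  qed
  have IH: "(\<integral>\<^sup>+x. ennreal (mixed_partial js D (overlay (set js) x z)) * ?P x \<partial>(\<Pi>\<^sub>M i\<in>set js. lborel))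
      = ennreal (box_diff js a b D z) \<and> 0 \<le> box_diff js a b D z"
    using Cons.prems by (intro Cons.IH dist D(1) D_nonneg D_meas) auto
  have "(\<integral>\<^sup>+x. ennreal (f (overlay (set (j # js)) x z)) *
      (\<Prod>i\<in>set (j # js). indicator {a $ i..b $ i} (x i)) \<partial>(\<Pi>\<^sub>M i\<in>set (j # js). lborel))
    = (\<integral>\<^sup>+x. (\<integral>\<^sup>+t. ennreal (f (overlay (set (j # js)) (x(j := t)) z)) *
      (\<Prod>i\<in>set (j # js). indicator {a $ i..b $ i} ((x(j := t)) i)) \<partial>lborel) \<partial>(\<Pi>\<^sub>M i\<in>set js. lborel))"
    unfolding list.set(2)
  proof (rule product_nn_integral_insert)
    have [measurable]: "(\<lambda>x. x i :: real) \<in> borel_measurable (\<Pi>\<^sub>M i\<in>insert j (set js). lborel)"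
      if "i \<in> insert j (set js)" for i
      using measurable_component_singleton[OF that, of "\<lambda>i. lborel :: real measure"] by simp
    show "(\<lambda>x. ennreal (f (overlay (insert j (set js)) x z)) *
      (\<Prod>i\<in>insert j (set js). indicator {a $ i..b $ i} (x i)))
      \<in> borel_measurable (\<Pi>\<^sub>M i\<in>insert j (set js). lborel)"
      by measurable
  qed (use j in auto)
  also have "\<dots> = (\<integral>\<^sup>+x. ennreal (mixed_partial js D (overlay (set js) x z)) * ?P x \<partial>(\<Pi>\<^sub>M i\<in>set js. lborel))"
  proof (rule nn_integral_cong)
    fix x
    have "(\<lambda>t. f (upd j t (overlay (set js) x z))) \<in> borel_measurable borel" by measurable
    then have "(\<integral>\<^sup>+t. (ennreal (f (upd j t (overlay (set js) x z))) * indicator {a $ j..b $ j} t) * ?P x \<partial>lborel)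
      = ennreal (mixed_partial js D (overlay (set js) x z)) * ?P x"
      by (subst nn_integral_multc) (auto simp: FTC)
    then show "(\<integral>\<^sup>+t. ennreal (f (overlay (set (j # js)) (x(j := t)) z)) *
      (\<Prod>i\<in>set (j # js). indicator {a $ i..b $ i} ((x(j := t)) i)) \<partial>lborel)
      = ennreal (mixed_partial js D (overlay (set js) x z)) * ?P x"
      unfolding P_upd by (simp only: list.set(2) overlay_insert mult.assoc)
  qed
  also have "\<dots> = ennreal (box_diff js a b D z)" using IH by blast
  finally show ?case using IH by (simp add: f_def D_def)
qed

lemma emeasure_mixed_partial_cbox:
  fixes a b :: "real ^ 'n::finite"
  assumes "distinct js" "set js = UNIV" "has_partials js H" "\<And>y. 0 \<le> mixed_partial js H y"
    "mixed_partial js H \<in> borel_measurable borel" "\<And>i. a $ i \<le> b $ i"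
  shows "emeasure (density lborel (\<lambda>y. ennreal (mixed_partial js H y))) (cbox a b)
    = ennreal (box_diff js a b H b)" and "0 \<le> box_diff js a b H b"
proof -
  have meas: "(\<lambda>x. \<chi> i. x i) \<in> borel_measurable (\<Pi>\<^sub>M i\<in>UNIV::'n set. lborel :: real measure)"
    using measurable_overlay[of UNIV 0] by (simp add: overlay_def)
  have [measurable]: "mixed_partial js H \<in> borel_measurable borel" by fact
  have ind: "indicator (cbox a b) (\<chi> i. x i) = (\<Prod>i\<in>UNIV. indicator {a $ i..b $ i} (x i) :: ennreal)" for x
    by (auto simp: indicator_def mem_box_cart prod_zero_iff)
  note box = nn_integral_mixed_partial_box[OF assms(1,3,4,5), of a b b]
  show "0 \<le> box_diff js a b H b" using box assms by simp
  have "emeasure (density lborel (\<lambda>y. ennreal (mixed_partial js H y))) (cbox a b)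
      = (\<integral>\<^sup>+y. ennreal (mixed_partial js H y) * indicator (cbox a b) y \<partial>lborel)"
    by (subst emeasure_density) auto
  also have "\<dots> = (\<integral>\<^sup>+x. ennreal (mixed_partial js H (\<chi> i. x i)) *
      (\<Prod>i\<in>UNIV. indicator {a $ i..b $ i} (x i)) \<partial>(\<Pi>\<^sub>M i\<in>UNIV. lborel))"
    by (subst lborel_vec_eq, subst nn_integral_distr[OF meas]) (auto simp: ind)
  also have "\<dots> = ennreal (box_diff js a b H b)"
    using box assms by (simp add: overlay_def)
  finally show "emeasure (density lborel (\<lambda>y. ennreal (mixed_partial js H y))) (cbox a b)
    = ennreal (box_diff js a b H b)" .
qed

section \<open>The distribution function of the random vector\<close>

lemma box_diff_minus:
  "box_diff js a b (\<lambda>y. H1 y - H2 y) z = box_diff js a b H1 z - box_diff js a b H2 z"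
proof (induction js arbitrary: H1 H2)
  case (Cons j js)
  have "(\<lambda>y. (H1 (upd j (b $ j) y) - H2 (upd j (b $ j) y)) - (H1 (upd j (a $ j) y) - H2 (upd j (a $ j) y)))
     = (\<lambda>y. (H1 (upd j (b $ j) y) - H1 (upd j (a $ j) y)) - (H2 (upd j (b $ j) y) - H2 (upd j (a $ j) y)))"
    by (simp add: fun_eq_iff)
  then show ?case
    using Cons.IH[of "\<lambda>y. H1 (upd j (b $ j) y) - H1 (upd j (a $ j) y)"
        "\<lambda>y. H2 (upd j (b $ j) y) - H2 (upd j (a $ j) y)"]
    by (simp only: box_diff.simps)
qed simp

lemma box_diff_upd:
  "j \<notin> set js \<Longrightarrow> box_diff js a b (\<lambda>y. H (upd j c y)) z = box_diff js a b H (upd j c z)"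
proof (induction js arbitrary: H)
  case (Cons i js)
  then have "i \<noteq> j" "j \<notin> set js" by auto
  then show ?case
    using Cons.IH[of "\<lambda>y. H (upd i (b $ i) y) - H (upd i (a $ i) y)"]
    by (simp add: upd_commute[of j i])
qed simp

lemma box_diff_cong:
  "(\<And>i. i \<in> set js \<Longrightarrow> a $ i = a' $ i) \<Longrightarrow> box_diff js a b H z = box_diff js a' b H z"
  by (induction js arbitrary: H) auto

lemma box_diff_tendsto_0:
  "(\<And>y. ((\<lambda>t. H t y) \<longlongrightarrow> 0) F) \<Longrightarrow> ((\<lambda>t. box_diff js a b (H t) z) \<longlongrightarrow> 0) F"
proof (induction js arbitrary: H)
  case (Cons j js)
  have "((\<lambda>t. H t (upd j (b $ j) y) - H t (upd j (a $ j) y)) \<longlongrightarrow> 0 - 0) F" for y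
    by (intro tendsto_diff Cons.prems)
  then show ?case using Cons.IH[of "\<lambda>t y. H t (upd j (b $ j) y) - H t (upd j (a $ j) y)"] by simp
qed simp

text \<open>
  The lower bounds are removed one coordinate at a time. As the bound for \<open>j\<close> tends to \<open>-\<infinity>\<close>, the
  set increases to the one without it, and the subtracted term of the difference in \<open>j\<close> vanishes.
\<close>
lemma measure_lower_orthant:
  fixes N :: "(real ^ 'n::finite) measure"
  assumes "finite_measure N" and sets: "sets N = sets borel"
    and lim: "\<And>j y. (\<lambda>m. F (upd j (- real m) y)) \<longlonglongrightarrow> 0"
    and "distinct js"
    and "\<And>a. (\<And>i. i \<in> set js \<Longrightarrow> a $ i \<le> b $ i) \<Longrightarrow>
      measure N {x. \<forall>i. x $ i \<le> b $ i \<and> (i \<in> set js \<longrightarrow> a $ i \<le> x $ i)} = box_diff js a b F b"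
  shows "measure N {x. \<forall>i. x $ i \<le> b $ i} = F b"
  using assms(4,5)
proof (induction js)
  case Nil
  then show ?case by simp
next
  case (Cons j js)
  interpret finite_measure N by fact
  define R where "R ks a = {x. \<forall>i. x $ i \<le> b $ i \<and> (i \<in> set ks \<longrightarrow> a $ i \<le> x $ i)}"
    for ks and a :: "real ^ 'n"
  have meas: "R ks a \<in> sets N" for ks a
    unfolding sets R_def
    by (intro borel_closed closed_Collect_all closed_Collect_conj closed_Collect_imp
        closed_Collect_le continuous_intros) auto
  have j: "j \<notin> set js" "distinct js" using Cons.prems by auto
  have "measure N (R js a) = box_diff js a b F b" if a: "\<And>i. i \<in> set js \<Longrightarrow> a $ i \<le> b $ i" for a
  proof (rule LIMSEQ_unique)
    define A where "A m = R (j # js) (upd j (- real m) a)" for m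
    have "incseq A"
    proof (rule incseq_SucI)
      show "A m \<subseteq> A (Suc m)" for m
        by (fastforce simp: A_def R_def upd_nth)
    qed
    moreover have "(\<Union>m. A m) = R js a"
    proof safe
      fix x m assume "x \<in> A m"
      then show "x \<in> R js a" using j by (auto simp: A_def R_def upd_nth split: if_splits)
    next
      fix x assume x: "x \<in> R js a"
      obtain m where "- x $ j \<le> real m" using real_arch_simple by blast
      then have "x \<in> A m" using x by (auto simp: A_def R_def upd_nth)
      then show "x \<in> (\<Union>m. A m)" by blast
    qed
    ultimately show "(\<lambda>m. measure N (A m)) \<longlonglongrightarrow> measure N (R js a)"
      using finite_Lim_measure_incseq[of A] meas by (auto simp: A_def)
    have "(\<lambda>m. box_diff js a b F b - box_diff js a b (\<lambda>y. F (upd j (- real m) y)) b) \<longlonglongrightarrow> box_diff js a b F b - 0"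
      by (intro tendsto_diff tendsto_const box_diff_tendsto_0 lim)
    moreover have "eventually (\<lambda>m. measure N (A m)
        = box_diff js a b F b - box_diff js a b (\<lambda>y. F (upd j (- real m) y)) b) sequentially"
    proof -
      have "eventually (\<lambda>m. - b $ j \<le> real m) sequentially"
        using filterlim_real_sequentially by (simp add: filterlim_at_top)
      then show ?thesis
      proof eventually_elim
        case (elim m)
        let ?a = "upd j (- real m) a"
        have "measure N (A m) = box_diff (j # js) ?a b F b"
          unfolding A_def R_def using elim a by (intro Cons.prems(2)) (auto simp: upd_nth)
        also have "\<dots> = box_diff js ?a b (\<lambda>y. F (upd j (b $ j) y)) b
            - box_diff js ?a b (\<lambda>y. F (upd j (- real m) y)) b"
          by (simp add: box_diff_minus upd_nth)
        also have "box_diff js ?a b (\<lambda>y. F (upd j (b $ j) y)) b = box_diff js ?a b F b"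
          using box_diff_upd[OF j(1)] by simp
        also have "box_diff js ?a b = box_diff js a b"
          by (intro ext box_diff_cong) (use j in \<open>auto simp: upd_nth\<close>)
        finally show ?case .
      qed
    qed
    ultimately show "(\<lambda>m. measure N (A m)) \<longlonglongrightarrow> box_diff js a b F b"
      by (simp add: tendsto_cong)
  qed
  then show ?case using Cons.IH j by (simp add: R_def)
qed

lemma gev_cdf_tendsto_0:
  assumes G: "gev_generating \<mu> (G :: real ^ 'n::finite \<Rightarrow> real)"
  shows "(\<lambda>m. exp (- G (expv (- upd j (- real m) y)))) \<longlonglongrightarrow> 0"
proof -
  have "expv (- y) \<in> nonneg_orthant" by (simp add: pos_orthant_nonneg expv_pos)
  then have "filterlim (\<lambda>t. G (\<chi> k. if k = j then t else expv (- y) $ k)) at_top at_top"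
    using G by (simp add: gev_generating_def)
  moreover have "filterlim (\<lambda>m. exp (real m)) at_top sequentially"
    by (rule filterlim_compose[OF exp_at_top filterlim_real_sequentially])
  ultimately have "filterlim (\<lambda>m. G (\<chi> k. if k = j then exp (real m) else expv (- y) $ k)) at_top sequentially"
    by (rule filterlim_compose)
  moreover have "(\<chi> k. if k = j then exp (real m) else expv (- y) $ k) = expv (- upd j (- real m) y)" for m
    by (simp add: vec_eq_iff upd_nth)
  ultimately have "filterlim (\<lambda>m. - G (expv (- upd j (- real m) y))) at_bot sequentially"
    by (simp add: filterlim_uminus_at_top)
  then show ?thesis by (rule filterlim_compose[OF exp_at_bot])
qed

lemma gev_cdf:
  fixes \<epsilon> :: "'a \<Rightarrow> real ^ 'n::finite"
  assumes G: "gev_generating \<mu> G" and \<epsilon>: "gev_random_vector G P \<epsilon>"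
  shows "measure P {\<omega> \<in> space P. \<forall>i. \<epsilon> \<omega> $ i \<le> b $ i} = exp (- G (expv (- b)))"
proof -
  let ?F = "\<lambda>y. exp (- G (expv (- y)))"
  have expv_eq: "(\<lambda>y. exp (- G (\<chi> i. exp (- (y $ i))))) = ?F"
    by (simp add: expv_def)
  interpret prob_space P using \<epsilon> by (simp add: gev_random_vector_def)
  obtain js where js: "distinct js" "set js = UNIV"
    and nonneg: "\<And>y. 0 \<le> mixed_partial js ?F y"
    and distr: "distributed P lborel \<epsilon> (\<lambda>y. ennreal (mixed_partial js ?F y))"
    using \<epsilon> unfolding gev_random_vector_def Let_def expv_eq by blast
  have [measurable]: "\<epsilon> \<in> borel_measurable P" using distributed_measurable[OF distr] by simp
  define N where "N = distr P borel \<epsilon>"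
  have N: "N = density lborel (\<lambda>y. ennreal (mixed_partial js ?F y))"
    using distributed_distr_eq_density[OF distr] by (simp add: N_def cong: distr_cong)
  interpret N: prob_space N unfolding N_def by (rule prob_space_distr) simp
  have "(\<lambda>y. ennreal (mixed_partial js ?F y)) \<in> borel_measurable borel"
    using distributed_borel_measurable[OF distr] by simp
  then have "(\<lambda>y. enn2real (ennreal (mixed_partial js ?F y))) \<in> borel_measurable borel" by measurable
  then have meas: "mixed_partial js ?F \<in> borel_measurable borel" using nonneg by simp
  have "measure N {x. \<forall>i. x $ i \<le> b $ i} = ?F b"
  proof (rule measure_lower_orthant)
    show "finite_measure N" by (rule N.finite_measure_axioms)
    show "sets N = sets borel" by (simp add: N_def)
    show "(\<lambda>m. ?F (upd j (- real m) y)) \<longlonglongrightarrow> 0" for j y by (rule gev_cdf_tendsto_0[OF G])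
    show "distinct js" by fact
    fix a :: "real ^ 'n" assume a: "\<And>i. i \<in> set js \<Longrightarrow> a $ i \<le> b $ i"
    have "{x. \<forall>i. x $ i \<le> b $ i \<and> (i \<in> set js \<longrightarrow> a $ i \<le> x $ i)} = cbox a b"
      using js by (auto simp: mem_box_cart)
    moreover have "emeasure N (cbox a b) = ennreal (box_diff js a b ?F b)" "0 \<le> box_diff js a b ?F b"
      unfolding N using js nonneg meas a gev_cdf_partials[OF G js(1)]
      by (auto intro!: emeasure_mixed_partial_cbox)
    ultimately show "measure N {x. \<forall>i. x $ i \<le> b $ i \<and> (i \<in> set js \<longrightarrow> a $ i \<le> x $ i)} = box_diff js a b ?F b"
      by (simp add: measure_def)
  qed
  moreover have "{x :: real ^ 'n. \<forall>i. x $ i \<le> b $ i} \<in> sets borel"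
    by (intro borel_closed closed_Collect_all closed_Collect_le continuous_intros)
  then have "measure N {x. \<forall>i. x $ i \<le> b $ i} = measure P {\<omega> \<in> space P. \<forall>i. \<epsilon> \<omega> $ i \<le> b $ i}"
    unfolding N_def by (subst measure_distr) (auto intro!: arg_cong2[where f = measure])
  ultimately show ?thesis by simp
qed

section \<open>The surplus function\<close>

lemma gev_max_cdf:
  fixes \<epsilon> :: "'a \<Rightarrow> real ^ 'n::finite"
  assumes G: "gev_generating \<mu> G" and \<epsilon>: "gev_random_vector G P \<epsilon>"
  shows "measure P {\<omega> \<in> space P. (MAX i. u $ i + \<epsilon> \<omega> $ i) \<le> t} = exp (- (exp (- t / \<mu>) * G (expv u)))"
proof -
  define b where "b = (\<chi> i. t - u $ i)"
  have "(MAX i. u $ i + \<epsilon> \<omega> $ i) \<le> t \<longleftrightarrow> (\<forall>i. \<epsilon> \<omega> $ i \<le> b $ i)" for \<omega>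
    using Max_vec_le_iff[of "u + \<epsilon> \<omega>" t] by (simp add: b_def algebra_simps)
  moreover have "expv (- b) = exp (- t) *\<^sub>R expv u"
    by (simp add: vec_eq_iff b_def exp_add[symmetric])
  moreover have "G (exp (- t) *\<^sub>R expv u) = exp (- t / \<mu>) * G (expv u)"
    using gev_homogeneous[OF G expv_pos, of "exp (- t)" u] by (simp add: powr_def)
  ultimately show ?thesis using gev_cdf[OF G \<epsilon>, of b] by simp
qed

text \<open>
  If \<open>G(e\<^sup>u) = 0\<close>, then \<open>max\<^sub>i (u\<^sub>i + \<epsilon>\<^sub>i) \<le> t\<close> would hold almost surely for every real \<open>t\<close>.
\<close>
lemma gev_pos:
  fixes \<epsilon> :: "'a \<Rightarrow> real ^ 'n::finite"
  assumes G: "gev_generating \<mu> G" and \<epsilon>: "gev_random_vector G P \<epsilon>"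
    and x: "x \<in> pos_orthant"
  shows "0 < G x"
proof (rule ccontr)
  assume "\<not> 0 < G x"
  moreover have "0 \<le> G x" using G pos_orthant_nonneg[OF x] by (simp add: gev_generating_def)
  ultimately have G0: "G x = 0" by simp
  define u where "u = (\<chi> i. ln (x $ i))"
  have u: "expv u = x" using x by (simp add: vec_eq_iff u_def pos_orthant_def)
  interpret prob_space P using \<epsilon> by (simp add: gev_random_vector_def)
  have int: "integrable P \<epsilon>" using \<epsilon> by (simp add: gev_random_vector_def)
  define Z where "Z \<omega> = (MAX i. u $ i + \<epsilon> \<omega> $ i)" for \<omega>
  have Z [measurable]: "Z \<in> borel_measurable P"
    using integrable_Max_vec[OF prob_space_axioms int, of u] by (auto simp: Z_def[abs_def])
  interpret Z: real_distribution "distr P borel Z" by (rule real_distribution_distr) simp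
  have "cdf (distr P borel Z) t = 1" for t
  proof -
    have "cdf (distr P borel Z) t = measure P {\<omega> \<in> space P. Z \<omega> \<le> t}"
      unfolding cdf_def by (subst measure_distr) (auto intro!: arg_cong2[where f = measure])
    then show ?thesis using gev_max_cdf[OF G \<epsilon>, of u t] by (simp add: Z_def u G0)
  qed
  then have "cdf (distr P borel Z) = (\<lambda>t. 1)" by auto
  then have "((\<lambda>t::real. 1::real) \<longlongrightarrow> 0) at_bot" using Z.cdf_lim_at_bot by simp
  then show False by (simp add: tendsto_const_iff)
qed

text \<open>
  The maxima shifted by \<open>- \<mu> ln G(e\<^sup>u)\<close> all have the same Gumbel law, and \<open>c\<close> is its mean.
\<close>
lemma surplus_eq:
  fixes \<epsilon> :: "'a \<Rightarrow> real ^ 'n::finite"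
  assumes G: "gev_generating \<mu> G" and \<epsilon>: "gev_random_vector G P \<epsilon>"
  shows "\<exists>c. \<forall>u. surplus P \<epsilon> u = \<mu> * ln (G (expv u)) + c"
proof -
  interpret prob_space P using \<epsilon> by (simp add: gev_random_vector_def)
  have int: "integrable P \<epsilon>" using \<epsilon> by (simp add: gev_random_vector_def)
  have \<mu>: "0 < \<mu>" using G by (rule gev_mu_pos)
  define Z where "Z u \<omega> = (MAX i. u $ i + \<epsilon> \<omega> $ i) - \<mu> * ln (G (expv u))" for u \<omega>
  have max_int: "integrable P (\<lambda>\<omega>. MAX i. u $ i + \<epsilon> \<omega> $ i)" for u
    using int by (rule integrable_Max_vec[OF prob_space_axioms])
  have Z_int: "integrable P (Z u)" for u unfolding Z_def using max_int by simp
  then have Z [measurable]: "Z u \<in> borel_measurable P" for u by auto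
  have cdf_Z: "cdf (distr P borel (Z u)) t = exp (- exp (- t / \<mu>))" for u t
  proof -
    have pos: "0 < G (expv u)" by (rule gev_pos[OF G \<epsilon> expv_pos])
    have "cdf (distr P borel (Z u)) t = measure P {\<omega> \<in> space P. Z u \<omega> \<le> t}"
      unfolding cdf_def by (subst measure_distr) (auto intro!: arg_cong2[where f = measure])
    also have "\<dots> = measure P {\<omega> \<in> space P. (MAX i. u $ i + \<epsilon> \<omega> $ i) \<le> t + \<mu> * ln (G (expv u))}"
      by (simp add: Z_def algebra_simps)
    also have "\<dots> = exp (- (exp (- (t + \<mu> * ln (G (expv u))) / \<mu>) * G (expv u)))"
      by (rule gev_max_cdf[OF G \<epsilon>])
    also have "- (t + \<mu> * ln (G (expv u))) / \<mu> = - t / \<mu> + - ln (G (expv u))"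
      using \<mu> by (simp add: field_simps)
    also have "exp (- t / \<mu> + - ln (G (expv u))) * G (expv u) = exp (- t / \<mu>)"
      unfolding exp_add using pos by (simp add: exp_minus)
    finally show ?thesis .
  qed
  have law: "distr P borel (Z u) = distr P borel (Z 0)" for u
    by (rule cdf_unique) (auto simp: cdf_Z)
  have "surplus P \<epsilon> u = \<mu> * ln (G (expv u)) + expectation (Z 0)" for u
  proof -
    have "surplus P \<epsilon> u = expectation (\<lambda>\<omega>. Z u \<omega> + \<mu> * ln (G (expv u)))"
      by (simp add: surplus_def Z_def)
    also have "\<dots> = expectation (Z u) + \<mu> * ln (G (expv u))"
      using Z_int by (simp add: prob_space)
    also have "expectation (Z u) = (\<integral>x. x \<partial>distr P borel (Z u))"
      by (subst integral_distr) auto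
    also have "\<dots> = expectation (Z 0)" unfolding law[of u] by (subst integral_distr) auto
    finally show ?thesis by simp
  qed
  then show ?thesis by blast
qed

theorem theorem3:
  fixes G :: "real ^ 'n::finite \<Rightarrow> real"
    and \<mu> M :: real
    and P :: "'a measure"
    and \<epsilon> :: "'a \<Rightarrow> real ^ 'n"
  assumes "gev_generating \<mu> G"
    and "\<forall>x\<in>pos_orthant.
           (\<Sum>i\<in>UNIV. partial_deriv i (partial_deriv i G) x * (x $ i)\<^sup>2) \<le> M * G x"
    and "gev_random_vector G P \<epsilon>"
  shows "strongly_convex_on (1 / (2 * (\<mu> * M + 1) - 1 / \<mu>)) norm1 unit_simplex
           (convex_conjugate (surplus P \<epsilon>))"
proof -
  obtain c where c: "\<And>u. surplus P \<epsilon> u = \<mu> * ln (G (expv u)) + c"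
    using surplus_eq[OF assms(1,3)] by blast
  have P: "prob_space P" "integrable P \<epsilon>" using assms(3) by (simp_all add: gev_random_vector_def)
  note smooth = gev_log_smooth[OF assms(1) assms(2)[rule_format] gev_pos[OF assms(1,3)] c refl]
  show ?thesis
    by (rule strongly_convex_conjugate[OF smooth(1) surplus_conjugate_finite[OF P] smooth(2)])
qed

end
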